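(* Let $(X,d,\alpha)$ be a computable metric space and let $S\subseteq X$. Suppose that $S$, as a subspace of $(X,d)$, is a manifold with boundary, and suppose that $S$ and $\partial S$ are semi-computable compact sets in $(X,d,\alpha)$. Then $S$ is a computable compact set in $(X,d,\alpha)$.
   Context: A computable metric space is a triple $(X,d,\alpha)$ where $(X,d)$ is a metric space and $\alpha=(\alpha_i)_{i\in\mathbb N}$ is a sequence with dense range in $(X,d)$ such that $(i,j)\mapsto d(\alpha_i,\alpha_j)$ is a computable function $\mathbb N^2\to\mathbb R$ (a function $g:\mathbb N^k\to\mathbb R$ is computable if there is a computable $G:\mathbb N^{k+1}\to\mathbb Q$ with $|g(x)-G(x,i)|<2^{-i}$ for all $x,i$). Fix a computable $q:\mathbb N\to\mathbb Q$ whose image is the set of positive rationals and computable $\tau_1,\tau_2:\mathbb N\to\mathbb N$ with $\{(\tau_1(i),\tau_2(i)):i\in\mathbb N\}=\mathbb N^2$; let $\lambda_i=\alpha_{\tau_1(i)}$, $\rho_i=q_{\tau_2(i)}$, $I_i=B(\lambda_i,\rho_i)$ (open ball). Fix computable $\sigma:\mathbb N^2\to\mathbb N$, $\eta:\mathbb N\to\mathbb N$ such that $\{(\sigma(j,0),\dots,\sigma(j,\eta(j))):j\in\mathbb N\}$ is the set of all nonempty finite sequences in $\mathbb N$; let $[j]=\{\sigma(j,i):0\le i\le\eta(j)\}$ and $J_j=\bigcup_{i\in[j]}I_i$. A set $K\subseteq X$ is a semi-computable compact set if $K$ is compact in $(X,d)$ and $\{j\in\mathbb N: K\subseteq J_j\}$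 is computably enumerable; it is a computable compact set if moreover $\{i\in\mathbb N: K\cap I_i\neq\emptyset\}$ is computably enumerable. A nonempty topological space $M$ is an $n$-manifold with boundary ($n\ge1$) if each point has a neighborhood homeomorphic to an open subset of $\mathbb H^n=\{(x_1,\dots,x_n)\in\mathbb R^n: x_n\ge0\}$; its boundary $\partial M$ is the set of points $x$ for which some homeomorphism from a neighborhood of $x$ onto an open subset of $\mathbb H^n$ sends $x$ into $\{x_n=0\}$. A manifold with boundary means an $n$-manifold with boundary for some $n\ge 1$. *)

theory Defs
  imports "HOL-Analysis.Analysis" "HOL-Library.Nat_Bijection"
begin

datatype recf = Zero | Succ | Proj nat | Comp recf "recf list" | Prim recf recf | Mini recf

inductive eval :: "recf \<Rightarrow> nat list \<Rightarrow> nat \<Rightarrow> bool" where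
  eval_zero: "eval Zero xs 0"
| eval_succ: "eval Succ (x # xs) (Suc x)"
| eval_proj: "i < length xs \<Longrightarrow> eval (Proj i) xs (xs ! i)"
| eval_comp: "list_all2 (\<lambda>g y. eval g xs y) gs ys \<Longrightarrow> eval f ys z \<Longrightarrow> eval (Comp f gs) xs z"
| eval_prim0: "eval f xs z \<Longrightarrow> eval (Prim f g) (0 # xs) z"
| eval_primS: "eval (Prim f g) (n # xs) y \<Longrightarrow> eval g (y # n # xs) z
     \<Longrightarrow> eval (Prim f g) (Suc n # xs) z"
| eval_mini: "eval f (n # xs) 0 \<Longrightarrow> (\<forall>m<n. \<exists>y. eval f (m # xs) y \<and> 0 < y)
     \<Longrightarrow> eval (Mini f) xs n"

definition computable_nat :: "nat \<Rightarrow> (nat list \<Rightarrow> nat) \<Rightarrow> bool" where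
  "computable_nat k f \<longleftrightarrow> (\<exists>r. \<forall>xs. length xs = k \<longrightarrow> eval r xs (f xs))"

definition rat_dec :: "nat \<Rightarrow> rat" where
  "rat_dec c = (case prod_decode c of (a, b) \<Rightarrow> of_int (int_decode a) / of_nat (b + 1))"

definition computable_rat :: "nat \<Rightarrow> (nat list \<Rightarrow> rat) \<Rightarrow> bool" where
  "computable_rat k G \<longleftrightarrow>
     (\<exists>c. computable_nat k c \<and> (\<forall>xs. length xs = k \<longrightarrow> rat_dec (c xs) = G xs))"

definition computable_real :: "nat \<Rightarrow> (nat list \<Rightarrow> real) \<Rightarrow> bool" where
  "computable_real k g \<longleftrightarrow>
     (\<exists>G. computable_rat (Suc k) G \<and>
        (\<forall>xs i. length xs = k \<longrightarrow> \<bar>g xs - real_of_rat (G (xs @ [i]))\<bar> < inverse (2 ^ i)))"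

definition ce_set :: "nat set \<Rightarrow> bool" where
  "ce_set A \<longleftrightarrow> (\<exists>r. \<forall>n. n \<in> A \<longleftrightarrow> (\<exists>y. eval r [n] y))"

definition computable_metric_space :: "'a set \<Rightarrow> ('a \<Rightarrow> 'a \<Rightarrow> real) \<Rightarrow> (nat \<Rightarrow> 'a) \<Rightarrow> bool" where
  "computable_metric_space X d \<alpha> \<longleftrightarrow>
     Metric_space X d \<and> range \<alpha> \<subseteq> X \<and>
     Metric_space.mtopology X d closure_of (range \<alpha>) = X \<and>
     computable_real 2 (\<lambda>xs. d (\<alpha> (xs ! 0)) (\<alpha> (xs ! 1)))"

definition standard_enums ::
  "(nat \<Rightarrow> rat) \<Rightarrow> (nat \<Rightarrow> nat) \<Rightarrow> (nat \<Rightarrow> nat) \<Rightarrow> (nat \<Rightarrow> nat \<Rightarrow> nat) \<Rightarrow> (nat \<Rightarrow> nat) \<Rightarrow> bool" where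
  "standard_enums q \<tau>1 \<tau>2 \<sigma> \<eta> \<longleftrightarrow>
     computable_rat 1 (\<lambda>xs. q (xs ! 0)) \<and> range q = {r. 0 < r} \<and>
     computable_nat 1 (\<lambda>xs. \<tau>1 (xs ! 0)) \<and> computable_nat 1 (\<lambda>xs. \<tau>2 (xs ! 0)) \<and>
     range (\<lambda>i. (\<tau>1 i, \<tau>2 i)) = UNIV \<and>
     computable_nat 2 (\<lambda>xs. \<sigma> (xs ! 0) (xs ! 1)) \<and> computable_nat 1 (\<lambda>xs. \<eta> (xs ! 0)) \<and>
     range (\<lambda>j. map (\<sigma> j) [0..<Suc (\<eta> j)]) = {l. l \<noteq> []}"

definition ratball ::
  "'a set \<Rightarrow> ('a \<Rightarrow> 'a \<Rightarrow> real) \<Rightarrow> (nat \<Rightarrow> 'a) \<Rightarrow> (nat \<Rightarrow> rat) \<Rightarrow> (nat \<Rightarrow> nat) \<Rightarrow> (nat \<Rightarrow> nat) \<Rightarrow> nat \<Rightarrow> 'a set" where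
  "ratball X d \<alpha> q \<tau>1 \<tau>2 i = Metric_space.mball X d (\<alpha> (\<tau>1 i)) (real_of_rat (q (\<tau>2 i)))"

definition ratunion ::
  "'a set \<Rightarrow> ('a \<Rightarrow> 'a \<Rightarrow> real) \<Rightarrow> (nat \<Rightarrow> 'a) \<Rightarrow> (nat \<Rightarrow> rat) \<Rightarrow> (nat \<Rightarrow> nat) \<Rightarrow> (nat \<Rightarrow> nat)
     \<Rightarrow> (nat \<Rightarrow> nat \<Rightarrow> nat) \<Rightarrow> (nat \<Rightarrow> nat) \<Rightarrow> nat \<Rightarrow> 'a set" where
  "ratunion X d \<alpha> q \<tau>1 \<tau>2 \<sigma> \<eta> j = (\<Union>i \<in> {\<sigma> j k | k. k \<le> \<eta> j}. ratball X d \<alpha> q \<tau>1 \<tau>2 i)"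

definition semicomputable_compact where
  "semicomputable_compact X d \<alpha> q \<tau>1 \<tau>2 \<sigma> \<eta> K \<longleftrightarrow>
     compactin (Metric_space.mtopology X d) K \<and>
     ce_set {j. K \<subseteq> ratunion X d \<alpha> q \<tau>1 \<tau>2 \<sigma> \<eta> j}"

definition computable_compact where
  "computable_compact X d \<alpha> q \<tau>1 \<tau>2 \<sigma> \<eta> K \<longleftrightarrow>
     semicomputable_compact X d \<alpha> q \<tau>1 \<tau>2 \<sigma> \<eta> K \<and>
     ce_set {i. K \<inter> ratball X d \<alpha> q \<tau>1 \<tau>2 i \<noteq> {}}"

text \<open>Closed half-space H^n = {x in R^n. x_n \<ge> 0}; R^n is Euclidean_space n, coordinates 0..n-1,
  so the last coordinate x_n is x (n - 1).\<close>
definition halfspace :: "nat \<Rightarrow> (nat \<Rightarrow> real) topology" where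
  "halfspace n = subtopology (Euclidean_space n) {x. 0 \<le> x (n - 1)}"

definition is_nhd :: "'a topology \<Rightarrow> 'a set \<Rightarrow> 'a \<Rightarrow> bool" where
  "is_nhd T N x \<longleftrightarrow> (\<exists>U. openin T U \<and> x \<in> U \<and> U \<subseteq> N \<and> N \<subseteq> topspace T)"

definition manifold_with_boundary :: "'a topology \<Rightarrow> nat \<Rightarrow> bool" where
  "manifold_with_boundary T n \<longleftrightarrow> 1 \<le> n \<and> topspace T \<noteq> {} \<and>
     (\<forall>x \<in> topspace T. \<exists>N V. is_nhd T N x \<and> openin (halfspace n) V \<and>
         subtopology T N homeomorphic_space subtopology (halfspace n) V)"

definition manifold_boundary :: "'a topology \<Rightarrow> nat \<Rightarrow> 'a set" where
  "manifold_boundary T n = {x \<in> topspace T. \<exists>N V f. is_nhd T N x \<and> openin (halfspace n) V \<and>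
         homeomorphic_map (subtopology T N) (subtopology (halfspace n) V) f \<and> f x (n - 1) = 0}"

end

(* Every point of S lies in the image of a chart f, defined on a closed cube or, near the boundary,
   on a cube cut off by the hyperplane of the boundary. A rational ball I_i is certified to meet S
   by a finite cover of S by rational balls coloured as follows: some lie in a fixed finite family F
   away from the f-image of the unit cube Q, one is I_i itself, and each of the others carries a
   coordinate and a sign, opposite signs being given to formally disjoint balls, which also keep away
   from balls fixed along the opposite face of Q. If I_i missed S, the preimages of the signed balls
   would cover Q in a way excluded by the Poincare-Miranda theorem. Conversely, if I_i meets the core
   of the chart at f p, then f {u. u t >= p t + e} and f {u. u t <= p t - e} are disjoint compact
   sets, so covering them by small balls gives such a certificate. The face of Q in the boundary
   cannot be guarded by fixed balls, because p may approach it; there the c.e. set of covers of the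
   boundary of S is used, and invariance of domain ensures that this boundary meets the chart only in
   that face. Certificates are c.e., and S is covered by finitely many chart cores. *)
theory Submission
  imports "HOL-Homology.Invariance_of_Domain" Defs
begin

text \<open>Semi-computability of \<open>S\<close> supplies only covers, so a ball can be shown to
  meet \<open>S\<close> only by refuting its absence; the topology of a chart provides the
  refutation. The chart itself need not be computable. It enters a certificate only through finitely
  many ball indices, chosen once and before the ball under test, and these are wired into the search
  as constants. Hence the guards on the faces must serve all points of the core at once, which is
  the reason for the fixed margins 1/4 and 3/4. Formal disjointness, a strict inequality between
  radii and the distance of centers, replaces disjointness of balls because it is c.e. The parameter
  region \<open>[-1,2]^n\<close> exceeds the unit cube so that the image of the cube and the part of
  \<open>S\<close> outside the open chart are disjoint compact sets, and the balls covering the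
  latter can avoid the former. For one chart the resulting c.e. set is only squeezed between the
  indices of balls meeting the core and those of balls meeting \<open>S\<close>; finitely many such
  sets have the desired set as their union.\<close>

section \<open>Computable and semidecidable predicates\<close>

text \<open>Truth is coded by 0, the value that \<^const>\<open>Mini\<close> searches for.\<close>
definition computable_pred :: "nat \<Rightarrow> (nat list \<Rightarrow> bool) \<Rightarrow> bool" where
  "computable_pred k P \<longleftrightarrow> computable_nat k (\<lambda>xs. if P xs then 0 else 1)"

lemma computable_nat_cong:
  assumes "computable_nat k f" "\<And>xs. length xs = k \<Longrightarrow> g xs = f xs"
  shows "computable_nat k g"
  using assms unfolding computable_nat_def by metis

lemma computable_pred_cong:
  assumes "computable_pred k P" "\<And>xs. length xs = k \<Longrightarrow> Q xs = P xs"
  shows "computable_pred k Q"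
  using assms(1) unfolding computable_pred_def
  by (rule computable_nat_cong) (simp add: assms(2))

lemma computable_nat_proj: "i < k \<Longrightarrow> computable_nat k (\<lambda>xs. xs ! i)"
  unfolding computable_nat_def by (metis eval_proj)

lemma computable_nat_comp:
  assumes "computable_nat (length gs) f" "\<And>g. g \<in> set gs \<Longrightarrow> computable_nat k g"
  shows "computable_nat k (\<lambda>xs. f (map (\<lambda>g. g xs) gs))"
proof -
  obtain r where r: "\<And>xs. length xs = length gs \<Longrightarrow> eval r xs (f xs)"
    using assms(1) unfolding computable_nat_def by blast
  have "\<exists>c. \<forall>g\<in>set gs. \<forall>xs. length xs = k \<longrightarrow> eval (c g) xs (g xs)"
    using assms(2) unfolding computable_nat_def by metis
  then obtain c where c: "\<And>g xs. g \<in> set gs \<Longrightarrow> length xs = k \<Longrightarrow> eval (c g) xs (g xs)"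
    by blast
  have "eval (Comp r (map c gs)) xs (f (map (\<lambda>g. g xs) gs))" if "length xs = k" for xs
  proof (rule eval_comp)
    show "list_all2 (\<lambda>g y. eval g xs y) (map c gs) (map (\<lambda>g. g xs) gs)"
      using c that by (auto simp: list_all2_map1 list_all2_map2 list_all2_same)
    show "eval r (map (\<lambda>g. g xs) gs) (f (map (\<lambda>g. g xs) gs))"
      by (rule r) simp
  qed
  then show ?thesis unfolding computable_nat_def by blast
qed

lemma computable_nat_comp1:
  assumes "computable_nat 1 (\<lambda>ys. f (ys ! 0))" "computable_nat k g"
  shows "computable_nat k (\<lambda>xs. f (g xs))"
  using computable_nat_comp[of "[g]" "\<lambda>ys. f (ys ! 0)" k] assms by auto

lemma computable_nat_comp2:
  assumes "computable_nat 2 (\<lambda>ys. f (ys ! 0) (ys ! 1))" "computable_nat k g" "computable_nat k h"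
  shows "computable_nat k (\<lambda>xs. f (g xs) (h xs))"
  using computable_nat_comp[of "[g, h]" "\<lambda>ys. f (ys ! 0) (ys ! 1)" k] assms
  by (auto simp: numeral_2_eq_2)

lemma computable_nat_Suc: "computable_nat k g \<Longrightarrow> computable_nat k (\<lambda>xs. Suc (g xs))"
proof (rule computable_nat_comp1[where f = Suc])
  have "eval Succ xs (Suc (xs ! 0))" if "length xs = 1" for xs
    using that by (cases xs) (auto intro: eval_succ)
  then show "computable_nat 1 (\<lambda>ys. Suc (ys ! 0))"
    unfolding computable_nat_def by blast
qed

lemma computable_nat_const: "computable_nat k (\<lambda>xs. c)"
proof (induction c)
  case 0
  then show ?case unfolding computable_nat_def by (metis eval_zero)
next
  case (Suc c)
  then show ?case by (rule computable_nat_Suc)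
qed

lemma computable_nat_tl:
  assumes "computable_nat k f"
  shows "computable_nat (Suc k) (\<lambda>xs. f (tl xs))"
proof -
  have eq: "map (\<lambda>g. g xs) (map (\<lambda>i ys. ys ! Suc i) [0..<k]) = tl xs" if "length xs = Suc k"
    for xs :: "nat list"
    using that by (auto intro!: nth_equalityI simp: nth_tl)
  have "computable_nat (Suc k) (\<lambda>xs. f (map (\<lambda>g. g xs) (map (\<lambda>i ys. ys ! Suc i) [0..<k])))"
    by (rule computable_nat_comp) (use assms in \<open>auto intro: computable_nat_proj\<close>)
  then show ?thesis by (rule computable_nat_cong) (subst eq, simp_all)
qed

lemma computable_nat_Cons:
  assumes "computable_nat (Suc k) f" "computable_nat k g"
  shows "computable_nat k (\<lambda>xs. f (g xs # xs))"
proof -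
  have eq: "map (\<lambda>h. h xs) (g # map (\<lambda>i ys. ys ! i) [0..<k]) = g xs # xs" if "length xs = k" for xs
    using that by (auto intro!: nth_equalityI)
  have "computable_nat k (\<lambda>xs. f (map (\<lambda>h. h xs) (g # map (\<lambda>i ys. ys ! i) [0..<k])))"
    by (rule computable_nat_comp) (use assms in \<open>auto intro: computable_nat_proj\<close>)
  then show ?thesis by (rule computable_nat_cong) (subst eq, simp_all)
qed

text \<open>\<open>Prim\<close> recurses on the head of its argument list and passes
  \<open>y # n # xs\<close> to its step function, which dictates the order here; the computed count
  \<open>h xs\<close> is put in front by \<open>computable_nat_Cons\<close>.\<close>

lemma computable_nat_rec:
  assumes "computable_nat k f" "computable_nat (Suc (Suc k)) g" "computable_nat k h"
  shows "computable_nat k (\<lambda>xs. rec_nat (f xs) (\<lambda>n y. g (y # n # xs)) (h xs))"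
proof -
  obtain rf where rf: "\<And>xs. length xs = k \<Longrightarrow> eval rf xs (f xs)"
    using assms(1) unfolding computable_nat_def by blast
  obtain rg where rg: "\<And>xs. length xs = Suc (Suc k) \<Longrightarrow> eval rg xs (g xs)"
    using assms(2) unfolding computable_nat_def by blast
  have ev: "eval (Prim rf rg) (m # xs) (rec_nat (f xs) (\<lambda>n y. g (y # n # xs)) m)"
    if "length xs = k" for m xs
  proof (induction m)
    case 0
    then show ?case using rf that by (auto intro: eval_prim0)
  next
    case (Suc m)
    then show ?case using rg that by (auto intro: eval_primS)
  qed
  have "computable_nat (Suc k) (\<lambda>zs. rec_nat (f (tl zs)) (\<lambda>n y. g (y # n # tl zs)) (hd zs))"
    unfolding computable_nat_def
  proof (intro exI allI impI)
    fix zs :: "nat list" assume "length zs = Suc k"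
    then obtain m xs where "zs = m # xs" "length xs = k" by (cases zs) auto
    then show "eval (Prim rf rg) zs (rec_nat (f (tl zs)) (\<lambda>n y. g (y # n # tl zs)) (hd zs))"
      using ev by simp
  qed
  from computable_nat_Cons[OF this assms(3)] show ?thesis by simp
qed

lemma computable_nat_pred: "computable_nat k g \<Longrightarrow> computable_nat k (\<lambda>xs. g xs - 1)"
proof (rule computable_nat_cong)
  assume "computable_nat k g"
  then show "computable_nat k (\<lambda>xs. rec_nat 0 (\<lambda>n y. (y # n # xs) ! 1) (g xs))"
    by (intro computable_nat_rec[where g = "\<lambda>ys. ys ! 1"] computable_nat_const computable_nat_proj) auto
  show "g xs - 1 = rec_nat 0 (\<lambda>n y. (y # n # xs) ! 1) (g xs)" for xs
    by (cases "g xs") auto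
qed

lemma computable_nat_add:
  assumes "computable_nat k g" "computable_nat k h"
  shows "computable_nat k (\<lambda>xs. g xs + h xs)"
proof (rule computable_nat_cong)
  show "computable_nat k (\<lambda>xs. rec_nat (g xs) (\<lambda>n y. Suc ((y # n # xs) ! 0)) (h xs))"
    by (intro computable_nat_rec[where g = "\<lambda>ys. Suc (ys ! 0)"] computable_nat_Suc
        computable_nat_proj assms) auto
  have eq: "x + m = rec_nat x (\<lambda>n y. Suc y) m" for x m :: nat
    by (induction m) auto
  show "g xs + h xs = rec_nat (g xs) (\<lambda>n y. Suc ((y # n # xs) ! 0)) (h xs)" for xs
    unfolding nth_Cons_0 by (rule eq)
qed

lemma computable_nat_diff:
  assumes "computable_nat k g" "computable_nat k h"
  shows "computable_nat k (\<lambda>xs. g xs - h xs)"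
proof (rule computable_nat_cong)
  show "computable_nat k (\<lambda>xs. rec_nat (g xs) (\<lambda>n y. (y # n # xs) ! 0 - 1) (h xs))"
    by (intro computable_nat_rec[where g = "\<lambda>ys. ys ! 0 - 1"] computable_nat_pred
        computable_nat_proj assms) auto
  have eq: "x - m = rec_nat x (\<lambda>n y. y - 1) m" for x m :: nat
    by (induction m) auto
  show "g xs - h xs = rec_nat (g xs) (\<lambda>n y. (y # n # xs) ! 0 - 1) (h xs)" for xs
    unfolding nth_Cons_0 by (rule eq)
qed

lemma computable_nat_mult:
  assumes "computable_nat k g" "computable_nat k h"
  shows "computable_nat k (\<lambda>xs. g xs * h xs)"
proof (rule computable_nat_comp2[OF _ assms])
  have "computable_nat 2 (\<lambda>xs. rec_nat 0 (\<lambda>n y. (y # n # xs) ! 0 + (y # n # xs) ! 2) (xs ! 1))"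
    by (intro computable_nat_rec[where g = "\<lambda>ys. ys ! 0 + ys ! 2"] computable_nat_add
        computable_nat_proj computable_nat_const) auto
  moreover have eq: "x * m = rec_nat 0 (\<lambda>n y. y + x) m" for x m :: nat
    by (induction m) auto
  ultimately show "computable_nat 2 (\<lambda>xs. xs ! 0 * xs ! 1)"
    by (elim computable_nat_cong) (simp add: eq[of "_ ! 0"] nth_Cons')
qed

lemma computable_nat_power2: "computable_nat k g \<Longrightarrow> computable_nat k (\<lambda>xs. 2 ^ g xs)"
proof (rule computable_nat_cong)
  assume "computable_nat k g"
  then show "computable_nat k (\<lambda>xs. rec_nat 1 (\<lambda>n y. (y # n # xs) ! 0 + (y # n # xs) ! 0) (g xs))"
    by (intro computable_nat_rec[where g = "\<lambda>ys. ys ! 0 + ys ! 0"] computable_nat_const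
        computable_nat_add computable_nat_proj) auto
  have eq: "(2::nat) ^ m = rec_nat 1 (\<lambda>n y. y + y) m" for m :: nat
    by (induction m) (auto simp: mult_2)
  show "2 ^ g xs = rec_nat 1 (\<lambda>n y. (y # n # xs) ! 0 + (y # n # xs) ! 0) (g xs)" for xs
    unfolding nth_Cons_0 by (rule eq)
qed

lemma computable_pred_not:
  assumes "computable_pred k P"
  shows "computable_pred k (\<lambda>xs. \<not> P xs)"
proof -
  have c: "computable_nat k (\<lambda>xs. 1 - (if P xs then 0 else 1))"
    using assms unfolding computable_pred_def by (intro computable_nat_diff computable_nat_const)
  show ?thesis
    unfolding computable_pred_def by (rule computable_nat_cong[OF c]) simp
qed

lemma computable_pred_disj:
  assumes "computable_pred k P" "computable_pred k Q"
  shows "computable_pred k (\<lambda>xs. P xs \<or> Q xs)"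
  unfolding computable_pred_def
  by (rule computable_nat_cong[OF computable_nat_mult[OF assms[unfolded computable_pred_def]]]) simp

lemma computable_pred_conj:
  assumes "computable_pred k P" "computable_pred k Q"
  shows "computable_pred k (\<lambda>xs. P xs \<and> Q xs)"
  using computable_pred_not[OF computable_pred_disj[OF assms[THEN computable_pred_not]]] by simp

lemma computable_pred_le:
  assumes "computable_nat k g" "computable_nat k h"
  shows "computable_pred k (\<lambda>xs. g xs \<le> h xs)"
proof -
  have c: "computable_nat k (\<lambda>xs. 1 - (1 - (g xs - h xs)))"
    by (intro computable_nat_diff computable_nat_const assms)
  show ?thesis
    unfolding computable_pred_def by (rule computable_nat_cong[OF c]) auto
qed

lemma computable_pred_less:
  assumes "computable_nat k g" "computable_nat k h"
  shows "computable_pred k (\<lambda>xs. g xs < h xs)"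
  using computable_pred_le[OF computable_nat_Suc[OF assms(1)] assms(2)] by (simp add: Suc_le_eq)

lemma computable_pred_eq:
  assumes "computable_nat k g" "computable_nat k h"
  shows "computable_pred k (\<lambda>xs. g xs = h xs)"
  using computable_pred_conj[OF computable_pred_le[OF assms] computable_pred_le[OF assms(2,1)]]
  by (simp add: order_eq_iff)

lemma computable_pred_const: "computable_pred k (\<lambda>xs. b)"
  unfolding computable_pred_def by (rule computable_nat_const)

lemma computable_nat_if:
  assumes "computable_pred k P" "computable_nat k g" "computable_nat k h"
  shows "computable_nat k (\<lambda>xs. if P xs then g xs else h xs)"
proof -
  have c: "computable_nat k (\<lambda>xs. (1 - (if P xs then 0 else 1)) * g xs + (if P xs then 0 else 1) * h xs)"
    using assms(1) unfolding computable_pred_def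
    by (intro computable_nat_add computable_nat_mult computable_nat_diff computable_nat_const assms)
  show ?thesis by (rule computable_nat_cong[OF c]) auto
qed

lemma computable_nat_Least:
  assumes "computable_pred (Suc k) P" "\<And>xs. length xs = k \<Longrightarrow> \<exists>m. P (m # xs)"
  shows "computable_nat k (\<lambda>xs. LEAST m. P (m # xs))"
proof -
  obtain r where r: "\<And>xs. length xs = Suc k \<Longrightarrow> eval r xs (if P xs then 0 else 1)"
    using assms(1) unfolding computable_pred_def computable_nat_def by blast
  have "eval (Mini r) xs (LEAST m. P (m # xs))" if len: "length xs = k" for xs
  proof (rule eval_mini)
    have "P ((LEAST m. P (m # xs)) # xs)"
      using assms(2)[OF len] by (auto intro: LeastI)
    then show "eval r ((LEAST m. P (m # xs)) # xs) 0"
      using r[of "(LEAST m. P (m # xs)) # xs"] len by auto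
    show "\<forall>m<LEAST m. P (m # xs). \<exists>y. eval r (m # xs) y \<and> 0 < y"
    proof (intro allI impI)
      fix m assume "m < (LEAST m. P (m # xs))"
      then have "\<not> P (m # xs)" by (rule not_less_Least)
      then show "\<exists>y. eval r (m # xs) y \<and> 0 < y"
        using r[of "m # xs"] len by auto
    qed
  qed
  then show ?thesis unfolding computable_nat_def by blast
qed

lemma computable_pred_bex:
  assumes "computable_pred (Suc k) P" "computable_nat k h"
  shows "computable_pred k (\<lambda>xs. \<exists>m\<le>h xs. P (m # xs))"
proof -
  \<comment> \<open>The disjunct with \<open>h\<close> makes the search total: it halts at
    \<open>h xs + 1\<close> at the latest. The bounded quantifier holds exactly if it halts within
    the bound.\<close>
  define Q where "Q ys \<longleftrightarrow> P ys \<or> h (tl ys) < hd ys" for ys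
  have hd: "computable_nat (Suc k) hd"
    by (rule computable_nat_cong[OF computable_nat_proj[of 0]]) (auto intro: hd_conv_nth)
  have Q: "computable_pred (Suc k) Q"
    unfolding Q_def using assms
    by (intro computable_pred_disj computable_pred_less computable_nat_tl hd)
  have ex: "\<exists>m. Q (m # xs)" for xs
    unfolding Q_def by (auto intro: exI[of _ "Suc (h xs)"])
  have L: "computable_nat k (\<lambda>xs. LEAST m. Q (m # xs))"
    by (rule computable_nat_Least[OF Q ex])
  have "(\<exists>m\<le>h xs. P (m # xs)) \<longleftrightarrow> (LEAST m. Q (m # xs)) \<le> h xs" for xs
  proof
    assume "\<exists>m\<le>h xs. P (m # xs)"
    then obtain m where "m \<le> h xs" "Q (m # xs)" by (auto simp: Q_def)
    then show "(LEAST m. Q (m # xs)) \<le> h xs" by (meson Least_le order_trans)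
  next
    assume "(LEAST m. Q (m # xs)) \<le> h xs"
    moreover have "Q ((LEAST m. Q (m # xs)) # xs)" using ex by (rule LeastI_ex)
    ultimately show "\<exists>m\<le>h xs. P (m # xs)" by (auto simp: Q_def)
  qed
  then show ?thesis
    by (intro computable_pred_cong[OF computable_pred_le[OF L assms(2)]]) simp
qed

lemma computable_pred_ball:
  assumes "computable_pred (Suc k) P" "computable_nat k h"
  shows "computable_pred k (\<lambda>xs. \<forall>m\<le>h xs. P (m # xs))"
  using computable_pred_not[OF computable_pred_bex[OF computable_pred_not[OF assms(1)] assms(2)]]
  by simp

lemma computable_pred_mem:
  assumes "finite A" "computable_nat k g"
  shows "computable_pred k (\<lambda>xs. g xs \<in> A)"
  using assms(1)
proof induction
  case empty
  then show ?case by (simp add: computable_pred_const)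
next
  case (insert a A)
  then have "computable_pred k (\<lambda>xs. g xs = a \<or> g xs \<in> A)"
    by (intro computable_pred_disj computable_pred_eq assms(2) computable_nat_const)
  then show ?case by simp
qed


lemma computable_nat_list:
  assumes "computable_nat m f" "\<And>xs. length xs = k \<Longrightarrow> length (L xs) = m"
    and "\<And>i. i < m \<Longrightarrow> computable_nat k (\<lambda>xs. L xs ! i)"
  shows "computable_nat k (\<lambda>xs. f (L xs))"
proof -
  have c: "computable_nat k (\<lambda>xs. f (map (\<lambda>g. g xs) (map (\<lambda>i xs. L xs ! i) [0..<m])))"
    by (rule computable_nat_comp) (use assms in auto)
  have "L xs = map (\<lambda>g. g xs) (map (\<lambda>i xs. L xs ! i) [0..<m])" if "length xs = k" for xs
    using assms(2)[OF that] by (auto intro!: nth_equalityI)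
  then show ?thesis
    by (intro computable_nat_cong[OF c]) metis
qed

lemma computable_pred_list:
  assumes "computable_pred m P" "\<And>xs. length xs = k \<Longrightarrow> length (L xs) = m"
    and "\<And>i. i < m \<Longrightarrow> computable_nat k (\<lambda>xs. L xs ! i)"
  shows "computable_pred k (\<lambda>xs. P (L xs))"
  using assms unfolding computable_pred_def by (rule computable_nat_list)

lemma computable_pred_finite_bex:
  assumes "finite G" "\<And>g. g \<in> G \<Longrightarrow> computable_pred k (P g)"
  shows "computable_pred k (\<lambda>xs. \<exists>g\<in>G. P g xs)"
  using assms
proof (induction G)
  case empty
  then show ?case by (simp add: computable_pred_const)
next
  case (insert g G)
  then have "computable_pred k (\<lambda>xs. P g xs \<or> (\<exists>g\<in>G. P g xs))"
    by (intro computable_pred_disj) auto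
  then show ?case by simp
qed

lemma computable_nat_nth_Suc_tl:
  "i < k \<Longrightarrow> computable_nat (Suc k) (\<lambda>xs. tl xs ! i)"
  by (rule computable_nat_cong[OF computable_nat_proj[of "Suc i"]]) (auto simp: nth_tl)

lemma computable_nat_hd: "computable_nat (Suc k) hd"
  by (rule computable_nat_cong[OF computable_nat_proj[of 0]]) (auto intro: hd_conv_nth)

lemma computable_nat_nth_Cons:
  assumes "computable_nat k g" "\<And>j. i = Suc j \<Longrightarrow> computable_nat k (\<lambda>xs. L xs ! j)"
  shows "computable_nat k (\<lambda>xs. (g xs # L xs) ! i)"
  using assms by (cases i) auto

section \<open>Simulation of partial recursive functions by total ones with a time bound\<close>

text \<open>Evaluation with a time bound, the first argument of \<open>E\<close>: the value 0 means "not yet", and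
  \<open>Suc y\<close> means that the result is \<open>y\<close>.\<close>
definition staged_eval :: "nat \<Rightarrow> recf \<Rightarrow> (nat list \<Rightarrow> nat) \<Rightarrow> bool" where
  "staged_eval k r E \<longleftrightarrow> computable_nat (Suc k) E \<and>
     (\<forall>xs t y. length xs = k \<longrightarrow> E (t # xs) = Suc y \<longrightarrow> eval r xs y) \<and>
     (\<forall>xs y. length xs = k \<longrightarrow> eval r xs y \<longrightarrow> (\<forall>\<^sub>F t in sequentially. E (t # xs) = Suc y))"

lemma staged_evalI:
  assumes "computable_nat (Suc k) E"
    and "\<And>xs t y. length xs = k \<Longrightarrow> E (t # xs) = Suc y \<Longrightarrow> eval r xs y"
    and "\<And>xs y. length xs = k \<Longrightarrow> eval r xs y \<Longrightarrow> \<forall>\<^sub>F t in sequentially. E (t # xs) = Suc y"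
  shows "staged_eval k r E"
  using assms unfolding staged_eval_def by blast

lemma staged_evalD:
  assumes "staged_eval k r E"
  shows "computable_nat (Suc k) E"
    and "length xs = k \<Longrightarrow> E (t # xs) = Suc y \<Longrightarrow> eval r xs y"
    and "length xs = k \<Longrightarrow> eval r xs y \<Longrightarrow> \<forall>\<^sub>F t in sequentially. E (t # xs) = Suc y"
  using assms unfolding staged_eval_def by blast+

inductive_cases eval_ZeroE: "eval Zero xs y"
inductive_cases eval_SuccE: "eval Succ xs y"
inductive_cases eval_ProjE: "eval (Proj i) xs y"
inductive_cases eval_CompE: "eval (Comp f gs) xs y"
inductive_cases eval_PrimE: "eval (Prim f g) xs y"
inductive_cases eval_MiniE: "eval (Mini f) xs y"

text \<open>All components run with the same time bound. Each converging computation is correct from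
  some stage on, so finitely many of them are correct simultaneously from some stage on.\<close>

lemma staged_eval_Comp:
  assumes f: "staged_eval (length gs) f Ef" and g: "\<And>g. g \<in> set gs \<Longrightarrow> staged_eval k g (Eg g)"
  shows "\<exists>E. staged_eval k (Comp f gs) E"
proof -
  define E where "E zs = (if \<exists>g\<in>set gs. Eg g zs = 0 then 0
      else Ef (hd zs # map (\<lambda>g. Eg g zs - 1) gs))" for zs
  have "staged_eval k (Comp f gs) E"
  proof (rule staged_evalI)
    have "computable_nat (Suc k) (\<lambda>zs. Ef (map (\<lambda>h. h zs) (hd # map (\<lambda>g zs. Eg g zs - 1) gs)))"
      by (rule computable_nat_comp)
        (use staged_evalD(1)[OF f] staged_evalD(1)[OF g] in
          \<open>auto intro: computable_nat_hd computable_nat_pred simp: o_def simp del: One_nat_def\<close>)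
    then have c: "computable_nat (Suc k) (\<lambda>zs. Ef (hd zs # map (\<lambda>g. Eg g zs - 1) gs))"
      by (simp add: o_def)
    show "computable_nat (Suc k) E"
      unfolding E_def using staged_evalD(1)[OF g] c
      by (intro computable_nat_if computable_pred_finite_bex computable_pred_eq
          computable_nat_const) auto
  next
    fix xs t y assume len: "length xs = k" and E: "E (t # xs) = Suc y"
    have nz: "Eg g (t # xs) \<noteq> 0" if "g \<in> set gs" for g
      using E that unfolding E_def by (auto split: if_splits)
    have ev: "eval g xs (Eg g (t # xs) - 1)" if "g \<in> set gs" for g
      using staged_evalD(2)[OF g[OF that] len] nz[OF that] by (metis Suc_pred' gr0I)
    have "Ef (t # map (\<lambda>g. Eg g (t # xs) - 1) gs) = Suc y"
      using E unfolding E_def by (auto split: if_splits)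
    then have "eval f (map (\<lambda>g. Eg g (t # xs) - 1) gs) y"
      by (intro staged_evalD(2)[OF f]) auto
    moreover have "list_all2 (\<lambda>g y. eval g xs y) gs (map (\<lambda>g. Eg g (t # xs) - 1) gs)"
      using ev by (auto simp: list_all2_conv_all_nth)
    ultimately show "eval (Comp f gs) xs y" by (intro eval_comp)
  next
    fix xs y assume len: "length xs = k" and "eval (Comp f gs) xs y"
    then obtain ys where ys: "list_all2 (\<lambda>g y. eval g xs y) gs ys" "eval f ys y"
      by (elim eval_CompE) blast
    have "\<forall>\<^sub>F t in sequentially. \<forall>i\<in>{..<length gs}. Eg (gs ! i) (t # xs) = Suc (ys ! i)"
    proof (intro eventually_ball_finite ballI)
      fix i assume "i \<in> {..<length gs}"
      then show "\<forall>\<^sub>F t in sequentially. Eg (gs ! i) (t # xs) = Suc (ys ! i)"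
        using ys(1) by (intro staged_evalD(3)[OF g] len) (auto simp: list_all2_conv_all_nth)
    qed auto
    moreover have "\<forall>\<^sub>F t in sequentially. Ef (t # ys) = Suc y"
      using ys by (intro staged_evalD(3)[OF f]) (auto simp: list_all2_lengthD)
    ultimately show "\<forall>\<^sub>F t in sequentially. E (t # xs) = Suc y"
    proof eventually_elim
      case (elim t)
      have "map (\<lambda>g. Eg g (t # xs) - 1) gs = ys"
        using elim(1) ys(1) by (auto intro!: nth_equalityI simp: list_all2_lengthD)
      moreover have "\<not> (\<exists>g\<in>set gs. Eg g (t # xs) = 0)"
        using elim(1) by (auto simp: in_set_conv_nth)
      ultimately show ?case
        using elim(2) unfolding E_def by simp
    qed
  qed
  then show ?thesis by blast
qed

lemma staged_eval_Prim:
  assumes f: "staged_eval k f Ef" and g: "staged_eval (Suc (Suc k)) g Eg"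
  shows "\<exists>E. staged_eval (Suc k) (Prim f g) E"
proof -
  \<comment> \<open>Inside the recursion the list reads \<open>y # n # t # m # ys\<close>: index 2
    is the time bound, index 0 the previous staged value, and \<open>- 1\<close> strips its
    \<open>Suc\<close>. The value 0 is absorbing.\<close>
  define G where "G zs = (if zs ! 0 = 0 then 0
      else Eg (zs ! 2 # (zs ! 0 - 1) # zs ! 1 # tl (tl (tl (tl zs)))))" for zs :: "nat list"
  define E where "E zs = rec_nat (Ef (zs ! 0 # tl (tl zs))) (\<lambda>n y. G (y # n # zs)) (zs ! 1)" for zs
  have tl2: "computable_nat (Suc (Suc m)) (\<lambda>xs. tl (tl xs) ! i)" if "i < m" for i m
    using computable_nat_tl[OF computable_nat_nth_Suc_tl[OF that]] by simp
  have tl4: "computable_nat (Suc (Suc (Suc (Suc m)))) (\<lambda>xs. tl (tl (tl (tl xs))) ! i)" if "i < m" for i m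
    using computable_nat_tl[OF computable_nat_tl[OF tl2[OF that]]] .
  have comp: "computable_nat (Suc (Suc k)) E"
    unfolding E_def
  proof (rule computable_nat_rec)
    show "computable_nat (Suc (Suc k)) (\<lambda>zs. Ef (zs ! 0 # tl (tl zs)))"
      by (rule computable_nat_list[OF staged_evalD(1)[OF f]])
        (auto intro!: computable_nat_nth_Cons computable_nat_proj tl2)
    show "computable_nat (Suc (Suc k)) (\<lambda>zs. zs ! 1)"
      by (intro computable_nat_proj) auto
    have "computable_nat (Suc (Suc (Suc (Suc k))))
        (\<lambda>zs. Eg (zs ! 2 # (zs ! 0 - 1) # zs ! 1 # tl (tl (tl (tl zs)))))"
      by (rule computable_nat_list[OF staged_evalD(1)[OF g]])
        (auto intro!: computable_nat_nth_Cons computable_nat_pred computable_nat_proj tl4 simp del: One_nat_def)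
    then show "computable_nat (Suc (Suc (Suc (Suc k)))) G"
      unfolding G_def
      by (intro computable_nat_if computable_pred_eq computable_nat_const computable_nat_proj) auto
  qed
  have E: "E (t # m # ys) = rec_nat (Ef (t # ys))
      (\<lambda>n y. if y = 0 then 0 else Eg (t # (y - 1) # n # ys)) m" for t m ys
    by (simp add: E_def G_def numeral_2_eq_2 cong: if_cong)
  have E0: "E (t # 0 # ys) = Ef (t # ys)" for t ys
    by (simp add: E)
  have ES: "E (t # Suc n # ys) =
      (if E (t # n # ys) = 0 then 0 else Eg (t # (E (t # n # ys) - 1) # n # ys))" for t n ys
    by (simp add: E)
  have sound: "eval (Prim f g) (m # ys) y"
    if "length ys = k" "E (t # m # ys) = Suc y" for ys m y t
    using that(2)
  proof (induction m arbitrary: y)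
    case 0
    then show ?case using staged_evalD(2)[OF f that(1)] by (auto simp: E0 intro: eval_prim0)
  next
    case (Suc m)
    then obtain z where z: "E (t # m # ys) = Suc z"
      by (cases "E (t # m # ys)") (auto simp: ES)
    then have "eval g (z # m # ys) y"
      using Suc.prems that(1) by (intro staged_evalD(2)[OF g]) (auto simp: ES)
    then show ?case using Suc.IH[OF z] by (rule eval_primS[rotated])
  qed
  have complete: "\<forall>\<^sub>F t in sequentially. E (t # m # ys) = Suc y"
    if "length ys = k" "eval (Prim f g) (m # ys) y" for ys m y
    using that(2)
  proof (induction m arbitrary: y)
    case 0
    then have "eval f ys y" by (auto elim: eval_PrimE)
    then show ?case using staged_evalD(3)[OF f that(1)] by (simp add: E0)
  next
    case (Suc m)
    then obtain z where z: "eval (Prim f g) (m # ys) z" "eval g (z # m # ys) y"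
      by (auto elim: eval_PrimE)
    have "\<forall>\<^sub>F t in sequentially. Eg (t # z # m # ys) = Suc y"
      using z(2) that(1) by (intro staged_evalD(3)[OF g]) auto
    with Suc.IH[OF z(1)] show ?case
      by eventually_elim (simp add: ES)
  qed
  have "staged_eval (Suc k) (Prim f g) E"
    by (rule staged_evalI[OF comp]) (auto simp: length_Suc_conv intro: sound complete)
  then show ?thesis by blast
qed

lemma staged_eval_Mini:
  assumes f: "staged_eval (Suc k) f Ef"
  shows "\<exists>E. staged_eval k (Mini f) E"
proof -
  \<comment> \<open>With \<open>zs = m # t # xs\<close>, the search stops at a candidate with staged
    value 0 (undecided) or 1 (result zero), and at \<open>t\<close> in any case. All smaller
    candidates then have verified positive results, as \<open>Mini\<close> demands; only a stop with
    value 1 counts as success.\<close>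
  define P where "P zs \<longleftrightarrow> zs ! 1 \<le> zs ! 0 \<or> Ef (zs ! 1 # zs ! 0 # tl (tl zs)) \<le> 1" for zs
  define M where "M zs = (LEAST m. P (m # zs))" for zs
  define E where "E zs = (if Ef (zs ! 0 # M zs # tl zs) = 1 then Suc (M zs) else 0)" for zs
  have ex: "\<exists>m. P (m # t # xs)" for t xs by (auto simp: P_def)
  have "staged_eval k (Mini f) E"
  proof (rule staged_evalI)
    have tl2: "computable_nat (Suc (Suc m)) (\<lambda>xs. tl (tl xs) ! i)" if "i < m" for i m
      using computable_nat_tl[OF computable_nat_nth_Suc_tl[OF that]] by simp
    have "computable_nat (Suc (Suc k)) (\<lambda>zs. Ef (zs ! 1 # zs ! 0 # tl (tl zs)))"
      by (rule computable_nat_list[OF staged_evalD(1)[OF f]])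
        (auto intro!: computable_nat_nth_Cons computable_nat_proj tl2)
    then have "computable_pred (Suc (Suc k)) P"
      unfolding P_def
      by (intro computable_pred_disj computable_pred_le computable_nat_const computable_nat_proj) auto
    then have M: "computable_nat (Suc k) M"
      unfolding M_def by (rule computable_nat_Least) (auto simp: length_Suc_conv ex)
    have "computable_nat (Suc k) (\<lambda>zs. Ef (zs ! 0 # M zs # tl zs))"
      by (rule computable_nat_list[OF staged_evalD(1)[OF f]])
        (auto intro!: computable_nat_nth_Cons computable_nat_proj computable_nat_nth_Suc_tl M)
    then show "computable_nat (Suc k) E"
      unfolding E_def
      by (intro computable_nat_if computable_pred_eq computable_nat_const computable_nat_Suc M)
  next
    fix xs t y assume len: "length xs = k" and E: "E (t # xs) = Suc y"
    then have y: "M (t # xs) = y" and Ef: "Ef (t # y # xs) = Suc 0"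
      by (auto simp: E_def split: if_splits)
    show "eval (Mini f) xs y"
    proof (rule eval_mini)
      show "eval f (y # xs) 0" using Ef len by (intro staged_evalD(2)[OF f]) auto
      show "\<forall>m<y. \<exists>z. eval f (m # xs) z \<and> 0 < z"
      proof (intro allI impI)
        fix m assume "m < y"
        then have "\<not> P (m # t # xs)" using y not_less_Least unfolding M_def by blast
        then have "2 \<le> Ef (t # m # xs)" by (simp add: P_def)
        then obtain z where "Ef (t # m # xs) = Suc (Suc z)"
          by (metis One_nat_def add_2_eq_Suc le_Suc_ex)
        then have "eval f (m # xs) (Suc z)" using len by (intro staged_evalD(2)[OF f]) auto
        then show "\<exists>z. eval f (m # xs) z \<and> 0 < z" by blast
      qed
    qed
  next
    fix xs y assume len: "length xs = k" and ev: "eval (Mini f) xs y"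
    from ev have y: "eval f (y # xs) 0" and "\<forall>m<y. \<exists>z. eval f (m # xs) z \<and> 0 < z"
      by (auto elim: eval_MiniE)
    then obtain z where z: "\<And>m. m < y \<Longrightarrow> eval f (m # xs) (z m) \<and> 0 < z m" by metis
    have "\<forall>\<^sub>F t in sequentially. \<forall>m\<in>{..<y}. Ef (t # m # xs) = Suc (z m)"
      using z len by (intro eventually_ball_finite ballI staged_evalD(3)[OF f]) auto
    moreover have "\<forall>\<^sub>F t in sequentially. Ef (t # y # xs) = Suc 0"
      using y len by (intro staged_evalD(3)[OF f]) auto
    moreover have "\<forall>\<^sub>F t in sequentially. y < t" by (rule eventually_gt_at_top)
    ultimately show "\<forall>\<^sub>F t in sequentially. E (t # xs) = Suc y"
    proof eventually_elim
      case (elim t)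
      have "M (t # xs) = y"
        unfolding M_def
      proof (rule Least_equality)
        show "P (y # t # xs)" using elim by (simp add: P_def)
        show "y \<le> m" if "P (m # t # xs)" for m
          using that elim z[of m] by (rule_tac ccontr) (auto simp: P_def)
      qed
      then show ?case using elim by (simp add: E_def)
    qed
  qed
  then show ?thesis by blast
qed

text \<open>In an arity where the program lacks the arguments that it reads, nothing is derivable by
  \<open>eval\<close>, and the constant 0 is a correct simulation.\<close>

lemma staged_eval_exists: "\<exists>E. staged_eval k r E"
proof (induction r arbitrary: k)
  case Zero
  have "staged_eval k Zero (\<lambda>xs. Suc 0)"
    by (rule staged_evalI) (auto intro: computable_nat_const eval_zero elim: eval_ZeroE)
  then show ?case by blast
next
  case Succ
  show ?case
  proof (cases k)
    case 0
    have "staged_eval k Succ (\<lambda>xs. 0)"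
      by (rule staged_evalI) (auto intro: computable_nat_const simp: 0 elim: eval_SuccE)
    then show ?thesis by blast
  next
    case (Suc k')
    have "staged_eval k Succ (\<lambda>xs. Suc (Suc (xs ! 1)))"
    proof (rule staged_evalI)
      show "computable_nat (Suc k) (\<lambda>xs. Suc (Suc (xs ! 1)))"
        using Suc by (intro computable_nat_Suc computable_nat_proj) simp
    qed (auto simp: Suc length_Suc_conv intro: eval_succ elim: eval_SuccE)
    then show ?thesis by blast
  qed
next
  case (Proj i)
  show ?case
  proof (cases "i < k")
    case True
    then have "computable_nat (Suc k) (\<lambda>xs. Suc (xs ! Suc i))"
      by (intro computable_nat_Suc computable_nat_proj) simp
    then have "staged_eval k (Proj i) (\<lambda>xs. Suc (xs ! Suc i))"
      using True by (intro staged_evalI) (auto intro: eval_proj elim: eval_ProjE)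
    then show ?thesis by blast
  next
    case False
    then have "staged_eval k (Proj i) (\<lambda>xs. 0)"
      by (intro staged_evalI) (auto intro: computable_nat_const elim: eval_ProjE)
    then show ?thesis by blast
  qed
next
  case (Comp f gs)
  obtain Ef where "staged_eval (length gs) f Ef" using Comp.IH(1) by blast
  moreover have "\<forall>g\<in>set gs. \<exists>E. staged_eval k g E" using Comp.IH(2) by blast
  then obtain Eg where "\<forall>g\<in>set gs. staged_eval k g (Eg g)"
    by (rule bchoice[THEN exE])
  ultimately show ?case by (intro staged_eval_Comp) auto
next
  case (Prim f g)
  show ?case
  proof (cases k)
    case 0
    have "staged_eval k (Prim f g) (\<lambda>xs. 0)"
      by (rule staged_evalI) (auto intro: computable_nat_const simp: 0 elim: eval_PrimE)
    then show ?thesis by blast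
  next
    case (Suc k')
    then show ?thesis using Prim.IH staged_eval_Prim by metis
  qed
next
  case (Mini f)
  then show ?case using staged_eval_Mini by metis
qed

section \<open>Semidecidable relations and their closure properties\<close>

text \<open>The Sigma_1 normal form, with the witness at the head of the list. Logical connectives
  and quantifiers act on it directly, whereas \<open>ce_set\<close> speaks of domains of
  programs.\<close>

definition semidec :: "nat \<Rightarrow> (nat list \<Rightarrow> bool) \<Rightarrow> bool" where
  "semidec k R \<longleftrightarrow>
     (\<exists>P. computable_pred (Suc k) P \<and> (\<forall>xs. length xs = k \<longrightarrow> (R xs \<longleftrightarrow> (\<exists>w. P (w # xs)))))"

lemma semidecI:
  assumes "computable_pred (Suc k) P" "\<And>xs. length xs = k \<Longrightarrow> R xs \<longleftrightarrow> (\<exists>w. P (w # xs))"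
  shows "semidec k R"
  using assms unfolding semidec_def by blast

lemma semidecE:
  assumes "semidec k R"
  obtains P where "computable_pred (Suc k) P"
    "\<And>xs. length xs = k \<Longrightarrow> R xs \<longleftrightarrow> (\<exists>w. P (w # xs))"
  using assms unfolding semidec_def by blast

text \<open>From left to right the witness is a stage by which the program has halted; from right to
  left \<open>Mini\<close> searches for the witness.\<close>

lemma ce_set_iff_semidec: "ce_set A \<longleftrightarrow> semidec 1 (\<lambda>xs. xs ! 0 \<in> A)"
proof
  assume "ce_set A"
  then obtain r where r: "\<And>n. n \<in> A \<longleftrightarrow> (\<exists>y. eval r [n] y)" unfolding ce_set_def by blast
  obtain E where E: "staged_eval 1 r E" using staged_eval_exists by blast
  show "semidec 1 (\<lambda>xs. xs ! 0 \<in> A)"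
  proof (rule semidecI)
    show "computable_pred (Suc 1) (\<lambda>zs. 0 < E zs)"
      by (intro computable_pred_less computable_nat_const staged_evalD(1)[OF E])
    fix xs :: "nat list" assume "length xs = 1"
    then obtain n where xs: "xs = [n]" by (auto simp: length_Suc_conv)
    have "(\<exists>y. eval r [n] y) \<longleftrightarrow> (\<exists>t. 0 < E (t # [n]))"
    proof
      assume "\<exists>y. eval r [n] y"
      then obtain y where "eval r [n] y" ..
      then have "\<forall>\<^sub>F t in sequentially. E (t # [n]) = Suc y"
        by (intro staged_evalD(3)[OF E]) auto
      then have "\<exists>t. E (t # [n]) = Suc y"
        by (intro eventually_happens') auto
      then show "\<exists>t. 0 < E (t # [n])" by (metis zero_less_Suc)
    next
      assume "\<exists>t. 0 < E (t # [n])"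
      then obtain t y where "E (t # [n]) = Suc y" by (auto simp: gr0_conv_Suc)
      then show "\<exists>y. eval r [n] y" by (intro exI staged_evalD(2)[OF E]) auto
    qed
    then show "xs ! 0 \<in> A \<longleftrightarrow> (\<exists>w. 0 < E (w # xs))" using r xs by simp
  qed
next
  assume "semidec 1 (\<lambda>xs. xs ! 0 \<in> A)"
  then obtain P where P: "computable_pred (Suc 1) P"
    "\<And>xs. length xs = 1 \<Longrightarrow> xs ! 0 \<in> A \<longleftrightarrow> (\<exists>w. P (w # xs))" by (rule semidecE) blast
  then obtain r where r: "\<And>xs. length xs = Suc 1 \<Longrightarrow> eval r xs (if P xs then 0 else 1)"
    unfolding computable_pred_def computable_nat_def by blast
  \<comment> \<open>Determinism of \<open>eval\<close>, read off from the simulation: both results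
    are its eventual value. It ensures that a decision program found to yield 0 is not one that
    answers 1.\<close>
  have det: "y = y'" if "eval r [w, n] y" "eval r [w, n] y'" for w n y y'
  proof -
    obtain E where E: "staged_eval 2 r E" using staged_eval_exists by blast
    have "\<forall>\<^sub>F t in sequentially. E (t # [w, n]) = Suc y"
      "\<forall>\<^sub>F t in sequentially. E (t # [w, n]) = Suc y'"
      using that by (intro staged_evalD(3)[OF E]; simp)+
    then have "\<forall>\<^sub>F t in sequentially. Suc y = Suc y'" by eventually_elim simp
    then show ?thesis by simp
  qed
  have "n \<in> A \<longleftrightarrow> (\<exists>y. eval (Mini r) [n] y)" for n
  proof
    assume "n \<in> A"
    then have ex: "\<exists>w. P (w # [n])" using P(2)[of "[n]"] by simp
    have "eval (Mini r) [n] (LEAST w. P (w # [n]))"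
    proof (rule eval_mini)
      show "eval r ((LEAST w. P (w # [n])) # [n]) 0"
        using r[of "(LEAST w. P (w # [n])) # [n]"] LeastI_ex[OF ex] by simp
      show "\<forall>m<LEAST w. P (w # [n]). \<exists>y. eval r (m # [n]) y \<and> 0 < y"
      proof (intro allI impI)
        fix m assume "m < (LEAST w. P (w # [n]))"
        then have "\<not> P (m # [n])" by (rule not_less_Least)
        then show "\<exists>y. eval r (m # [n]) y \<and> 0 < y" using r[of "m # [n]"] by auto
      qed
    qed
    then show "\<exists>y. eval (Mini r) [n] y" ..
  next
    assume "\<exists>y. eval (Mini r) [n] y"
    then obtain y where "eval r (y # [n]) 0" by (auto elim: eval_MiniE)
    with r[of "[y, n]"] det have "P (y # [n])" by (auto split: if_splits)
    then show "n \<in> A" using P(2)[of "[n]"] by auto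
  qed
  then show "ce_set A" unfolding ce_set_def by blast
qed

lemma semidec_list:
  assumes R: "semidec m R" and len: "\<And>xs. length xs = k \<Longrightarrow> length (L xs) = m"
    and L: "\<And>i. i < m \<Longrightarrow> computable_nat k (\<lambda>xs. L xs ! i)"
  shows "semidec k (\<lambda>xs. R (L xs))"
proof -
  obtain P where P: "computable_pred (Suc m) P"
    "\<And>xs. length xs = m \<Longrightarrow> R xs \<longleftrightarrow> (\<exists>w. P (w # xs))" using R by (rule semidecE) blast
  show ?thesis
  proof (rule semidecI)
    show "computable_pred (Suc k) (\<lambda>zs. P (hd zs # L (tl zs)))"
    proof (rule computable_pred_list[OF P(1)])
      show "computable_nat (Suc k) (\<lambda>xs. (hd xs # L (tl xs)) ! i)" if "i < Suc m" for i
        using that computable_nat_tl[OF L[of "i - 1"]]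
        by (cases i) (auto intro: computable_nat_hd)
    qed (use len in auto)
    show "R (L xs) \<longleftrightarrow> (\<exists>w. P (hd (w # xs) # L (tl (w # xs))))" if "length xs = k" for xs
      using P(2) len[OF that] by simp
  qed
qed

lemma semidec_computable_pred: "computable_pred k P \<Longrightarrow> semidec k P"
  by (rule semidecI[of _ "\<lambda>zs. P (tl zs)"])
    (auto intro: computable_pred_list computable_nat_nth_Suc_tl)

lemma computable_pred_drop_Suc:
  assumes "computable_pred (Suc k) P"
  shows "computable_pred (Suc (Suc k)) (\<lambda>zs. P (zs ! 0 # tl (tl zs)))"
proof (rule computable_pred_list[OF assms])
  show "computable_nat (Suc (Suc k)) (\<lambda>zs. (zs ! 0 # tl (tl zs)) ! i)" if "i < Suc k" for i
    using that computable_nat_tl[OF computable_nat_nth_Suc_tl[of "i - 1" k]]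
    by (cases i) (auto intro: computable_nat_proj)
qed auto

text \<open>The new witness is a common bound for the two old ones; the search below a bound is
  decidable.\<close>

lemma semidec_conj:
  assumes "semidec k R" "semidec k Q"
  shows "semidec k (\<lambda>xs. R xs \<and> Q xs)"
proof -
  obtain P where P: "computable_pred (Suc k) P"
    "\<And>xs. length xs = k \<Longrightarrow> R xs \<longleftrightarrow> (\<exists>w. P (w # xs))" using assms(1) by (rule semidecE) blast
  obtain P' where P': "computable_pred (Suc k) P'"
    "\<And>xs. length xs = k \<Longrightarrow> Q xs \<longleftrightarrow> (\<exists>w. P' (w # xs))" using assms(2) by (rule semidecE) blast
  show ?thesis
  proof (rule semidecI)
    show "computable_pred (Suc k) (\<lambda>zs. (\<exists>w\<le>zs ! 0. P ((w # zs) ! 0 # tl (tl (w # zs)))) \<and>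
        (\<exists>w\<le>zs ! 0. P' ((w # zs) ! 0 # tl (tl (w # zs)))))"
      by (intro computable_pred_conj computable_pred_bex[OF computable_pred_drop_Suc] P P'
          computable_nat_proj) auto
    show "R xs \<and> Q xs \<longleftrightarrow> (\<exists>w. (\<exists>v\<le>(w # xs) ! 0. P ((v # w # xs) ! 0 # tl (tl (v # w # xs)))) \<and>
        (\<exists>v\<le>(w # xs) ! 0. P' ((v # w # xs) ! 0 # tl (tl (v # w # xs)))))" if "length xs = k" for xs
      using P(2)[OF that] P'(2)[OF that] by simp (meson max.cobounded1 max.cobounded2)
  qed
qed

lemma semidec_disj:
  assumes "semidec k R" "semidec k Q"
  shows "semidec k (\<lambda>xs. R xs \<or> Q xs)"
proof -
  obtain P where P: "computable_pred (Suc k) P"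
    "\<And>xs. length xs = k \<Longrightarrow> R xs \<longleftrightarrow> (\<exists>w. P (w # xs))" using assms(1) by (rule semidecE) blast
  obtain P' where P': "computable_pred (Suc k) P'"
    "\<And>xs. length xs = k \<Longrightarrow> Q xs \<longleftrightarrow> (\<exists>w. P' (w # xs))" using assms(2) by (rule semidecE) blast
  show ?thesis
    by (rule semidecI[OF computable_pred_disj[OF P(1) P'(1)]]) (auto simp: P(2) P'(2))
qed

lemma computable_pred_drop_third:
  assumes "computable_pred (Suc (Suc k)) P"
  shows "computable_pred (Suc (Suc (Suc k))) (\<lambda>zs. P (zs ! 0 # zs ! 1 # tl (tl (tl zs))))"
proof (rule computable_pred_list[OF assms])
  show "computable_nat (Suc (Suc (Suc k))) (\<lambda>zs. (zs ! 0 # zs ! 1 # tl (tl (tl zs))) ! i)"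
    if "i < Suc (Suc k)" for i
    using that computable_nat_tl[OF computable_nat_tl[OF computable_nat_nth_Suc_tl[of "i - 2" k]]]
    by (cases i; cases "i - 1") (auto intro: computable_nat_proj)
qed auto

text \<open>One number bounds both the quantified value and its witness.\<close>

lemma semidec_ex:
  assumes "semidec (Suc k) R"
  shows "semidec k (\<lambda>xs. \<exists>m. R (m # xs))"
proof -
  obtain P where P: "computable_pred (Suc (Suc k)) P"
    "\<And>xs. length xs = Suc k \<Longrightarrow> R xs \<longleftrightarrow> (\<exists>w. P (w # xs))" using assms by (rule semidecE) blast
  have "computable_pred (Suc (Suc k)) (\<lambda>zs. \<exists>w\<le>zs ! 1. P ((w # zs) ! 0 # (w # zs) ! 1 # tl (tl (tl (w # zs)))))"
    by (intro computable_pred_bex[OF computable_pred_drop_third] P computable_nat_proj) auto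
  then have c: "computable_pred (Suc k) (\<lambda>ys. \<exists>m\<le>ys ! 0. \<exists>w\<le>(m # ys) ! 1.
      P ((w # m # ys) ! 0 # (w # m # ys) ! 1 # tl (tl (tl (w # m # ys)))))"
    by (rule computable_pred_bex) (auto intro: computable_nat_proj)
  show ?thesis
    by (rule semidecI[OF c]) (auto simp: P(2), meson max.cobounded1 max.cobounded2)
qed

text \<open>Collection: the witnesses for the finitely many \<open>m\<close> have a maximum, and
  this bound is the new witness.\<close>

lemma semidec_ball:
  assumes "semidec (Suc k) R" "computable_nat k h"
  shows "semidec k (\<lambda>xs. \<forall>m\<le>h xs. R (m # xs))"
proof -
  obtain P where P: "computable_pred (Suc (Suc k)) P"
    "\<And>xs. length xs = Suc k \<Longrightarrow> R xs \<longleftrightarrow> (\<exists>w. P (w # xs))" using assms(1) by (rule semidecE) blast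
  have "computable_pred (Suc (Suc k)) (\<lambda>zs. \<exists>w\<le>zs ! 1. P ((w # zs) ! 0 # (w # zs) ! 1 # tl (tl (tl (w # zs)))))"
    by (intro computable_pred_bex[OF computable_pred_drop_third] P computable_nat_proj) auto
  then have c: "computable_pred (Suc k) (\<lambda>ys. \<forall>m\<le>h (tl ys). \<exists>w\<le>(m # ys) ! 1.
      P ((w # m # ys) ! 0 # (w # m # ys) ! 1 # tl (tl (tl (w # m # ys)))))"
    by (rule computable_pred_ball) (auto intro: computable_nat_tl assms(2))
  have bound: "(\<forall>m\<le>l. \<exists>w. S m w) \<longleftrightarrow> (\<exists>v. \<forall>m\<le>l. \<exists>w\<le>v. S m w)" for l :: nat and S :: "nat \<Rightarrow> nat \<Rightarrow> bool"
  proof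
    assume "\<forall>m\<le>l. \<exists>w. S m w"
    then obtain w where w: "\<And>m. m \<le> l \<Longrightarrow> S m (w m)" by metis
    have "\<forall>m\<le>l. w m \<le> Max (w ` {..l})" by auto
    with w show "\<exists>v. \<forall>m\<le>l. \<exists>w\<le>v. S m w" by blast
  qed blast
  show ?thesis
  proof (rule semidecI[OF c])
    fix xs :: "nat list" assume "length xs = k"
    then show "(\<forall>m\<le>h xs. R (m # xs)) \<longleftrightarrow> (\<exists>v. \<forall>m\<le>h (tl (v # xs)). \<exists>w\<le>(m # v # xs) ! 1.
      P ((w # m # v # xs) ! 0 # (w # m # v # xs) ! 1 # tl (tl (tl (w # m # v # xs)))))"
      using bound[of "h xs" "\<lambda>m w. P (w # m # xs)"] by (simp add: P(2))
  qed
qed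

lemma semidec_finite_ball:
  assumes "finite G" "\<And>g. g \<in> G \<Longrightarrow> semidec k (R g)"
  shows "semidec k (\<lambda>xs. \<forall>g\<in>G. R g xs)"
  using assms
proof (induction G)
  case empty
  then show ?case by (simp add: computable_pred_const semidec_computable_pred)
next
  case (insert g G)
  then have "semidec k (\<lambda>xs. R g xs \<and> (\<forall>g\<in>G. R g xs))"
    by (intro semidec_conj) auto
  then show ?case by simp
qed

lemma semidec_finite_bex:
  assumes "finite G" "\<And>g. g \<in> G \<Longrightarrow> semidec k (R g)"
  shows "semidec k (\<lambda>xs. \<exists>g\<in>G. R g xs)"
  using assms
proof (induction G)
  case empty
  then show ?case by (simp add: computable_pred_const semidec_computable_pred)
next
  case (insert g G)
  then have "semidec k (\<lambda>xs. R g xs \<or> (\<exists>g\<in>G. R g xs))"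
    by (intro semidec_disj) auto
  then show ?case by simp
qed

lemma ce_set_Union:
  assumes "finite F" "\<And>A. A \<in> F \<Longrightarrow> ce_set A"
  shows "ce_set (\<Union>F)"
  using semidec_finite_bex[of F 1 "\<lambda>A xs. xs ! 0 \<in> A"] assms
  unfolding ce_set_iff_semidec by simp


section \<open>Rational numbers\<close>

lemma computable_nat_div2:
  assumes "computable_nat k g"
  shows "computable_nat k (\<lambda>xs. g xs div 2)"
proof (rule computable_nat_comp1[OF _ assms])
  have ex: "\<exists>m. n < 2 * Suc m" for n :: nat
    by (rule exI[of _ n]) simp
  have c: "computable_nat 1 (\<lambda>xs. LEAST m. (m # xs) ! 1 < 2 * Suc ((m # xs) ! 0))"
    by (rule computable_nat_Least)
      (auto intro!: computable_pred_less computable_nat_mult computable_nat_const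
        computable_nat_Suc computable_nat_proj ex simp del: mult_Suc_right)
  have "(LEAST m. n < 2 * Suc m) = n div 2" for n :: nat
    by (rule Least_equality) auto
  then show "computable_nat 1 (\<lambda>xs. xs ! 0 div 2)"
    by (intro computable_nat_cong[OF c]) simp
qed

lemma computable_pred_even:
  assumes "computable_nat k g"
  shows "computable_pred k (\<lambda>xs. even (g xs))"
proof -
  have c: "computable_pred k (\<lambda>xs. 2 * (g xs div 2) = g xs)"
    by (intro computable_pred_eq computable_nat_mult computable_nat_const computable_nat_div2 assms)
  show ?thesis by (rule computable_pred_cong[OF c]) (metis dvd_mult_div_cancel dvd_triv_left)
qed

text \<open>Doubling clears the division in the triangular number, so the graph of the pairing
  function is polynomial and decidable. Both decoding functions are then found by search on this
  graph.\<close>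

lemma two_mult_prod_encode: "2 * prod_encode (a, b) = (a + b) * Suc (a + b) + 2 * a"
proof -
  have "even ((a + b) * Suc (a + b))" by simp
  then show ?thesis by (simp add: prod_encode_def triangle_def del: mult_Suc_right)
qed

lemma prod_encode_eq_iff:
  "prod_encode (a, b) = c \<longleftrightarrow> 2 * c = (a + b) * Suc (a + b) + 2 * a"
  using two_mult_prod_encode[of a b] by auto

lemma computable_nat_fst_prod_decode:
  assumes "computable_nat k g"
  shows "computable_nat k (\<lambda>xs. fst (prod_decode (g xs)))"
proof (rule computable_nat_comp1[OF _ assms])
  define P where "P ys \<longleftrightarrow> (\<exists>b\<le>ys ! 1. 2 * ((b # ys) ! 2) =
      ((b # ys) ! 1 + (b # ys) ! 0) * Suc ((b # ys) ! 1 + (b # ys) ! 0) + 2 * ((b # ys) ! 1))"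
    for ys :: "nat list"
  have "computable_pred (Suc (Suc 1)) (\<lambda>zs. 2 * (zs ! 2) =
      (zs ! 1 + zs ! 0) * Suc (zs ! 1 + zs ! 0) + 2 * (zs ! 1))"
    by (intro computable_pred_eq computable_nat_mult computable_nat_add computable_nat_Suc
        computable_nat_const computable_nat_proj) auto
  then have "computable_pred (Suc 1) P"
    unfolding P_def by (rule computable_pred_bex) (auto intro: computable_nat_proj)
  moreover have P: "P (a # [n]) \<longleftrightarrow> a = fst (prod_decode n)" for a n
  proof -
    have "P (a # [n]) \<longleftrightarrow> (\<exists>b\<le>n. prod_encode (a, b) = n)"
      unfolding P_def prod_encode_eq_iff by simp
    also have "\<dots> \<longleftrightarrow> (\<exists>b. prod_encode (a, b) = n)"
      using le_prod_encode_2 by blast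
    also have "\<dots> \<longleftrightarrow> a = fst (prod_decode n)"
      by (metis prod.collapse prod_decode_inverse prod_encode_inverse fst_conv)
    finally show ?thesis .
  qed
  ultimately have c: "computable_nat 1 (\<lambda>xs. LEAST a. P (a # xs))"
    by (intro computable_nat_Least) (auto simp: length_Suc_conv)
  show "computable_nat 1 (\<lambda>xs. fst (prod_decode (xs ! 0)))"
    by (rule computable_nat_cong[OF c]) (auto simp: length_Suc_conv P Least_equality)
qed

lemma computable_nat_snd_prod_decode:
  assumes "computable_nat k g"
  shows "computable_nat k (\<lambda>xs. snd (prod_decode (g xs)))"
proof (rule computable_nat_comp1[OF _ assms])
  define P where "P ys \<longleftrightarrow> 2 * (ys ! 1) =
      (fst (prod_decode (ys ! 1)) + ys ! 0) * Suc (fst (prod_decode (ys ! 1)) + ys ! 0)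
        + 2 * fst (prod_decode (ys ! 1))"
    for ys :: "nat list"
  have "computable_pred (Suc 1) P"
    unfolding P_def
    by (intro computable_pred_eq computable_nat_mult computable_nat_add computable_nat_Suc
        computable_nat_fst_prod_decode computable_nat_const computable_nat_proj) auto
  moreover have P: "P (b # [n]) \<longleftrightarrow> b = snd (prod_decode n)" for b n
  proof -
    have "P (b # [n]) \<longleftrightarrow> prod_encode (fst (prod_decode n), b) = n"
      unfolding P_def prod_encode_eq_iff by simp
    also have "\<dots> \<longleftrightarrow> b = snd (prod_decode n)"
      by (metis prod.collapse prod_decode_inverse prod_encode_inverse snd_conv)
    finally show ?thesis .
  qed
  ultimately have c: "computable_nat 1 (\<lambda>xs. LEAST a. P (a # xs))"
    by (intro computable_nat_Least) (auto simp: length_Suc_conv)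
  show "computable_nat 1 (\<lambda>xs. snd (prod_decode (xs ! 0)))"
    by (rule computable_nat_cong[OF c]) (auto simp: length_Suc_conv P Least_equality)
qed

text \<open>\<open>int_decode\<close> maps even codes to nonnegative and odd codes to negative
  integers. The numerator is kept as a difference of two naturals, so that comparing rationals
  reduces to arithmetic on naturals.\<close>

definition pos_code :: "nat \<Rightarrow> nat" where
  "pos_code c = (if even (fst (prod_decode c)) then fst (prod_decode c) div 2 else 0)"

definition neg_code :: "nat \<Rightarrow> nat" where
  "neg_code c = (if even (fst (prod_decode c)) then 0 else Suc (fst (prod_decode c) div 2))"

definition den_code :: "nat \<Rightarrow> nat" where
  "den_code c = Suc (snd (prod_decode c))"

lemma rat_dec_eq: "real_of_rat (rat_dec c) = (real (pos_code c) - real (neg_code c)) / real (den_code c)"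
proof -
  obtain a b where ab: "prod_decode c = (a, b)" by fastforce
  have "real_of_int (int_decode a) = real (pos_code c) - real (neg_code c)"
    by (simp add: pos_code_def neg_code_def ab int_decode_def sum_decode_def)
  then show ?thesis
    by (simp add: rat_dec_def ab den_code_def of_rat_divide of_rat_add add.commute)
qed

lemma computable_nat_code:
  assumes "computable_nat k g"
  shows "computable_nat k (\<lambda>xs. pos_code (g xs))" "computable_nat k (\<lambda>xs. neg_code (g xs))"
    "computable_nat k (\<lambda>xs. den_code (g xs))"
  unfolding pos_code_def neg_code_def den_code_def
  by (intro computable_nat_if computable_pred_even computable_nat_div2 computable_nat_const
      computable_nat_Suc computable_nat_fst_prod_decode computable_nat_snd_prod_decode assms)+

text \<open>Multiply by \<open>d1 * d2 * d * e\<close> and move negative terms across: for natural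
  data both sides become sums of products of naturals, with no truncated subtraction. The letter
  \<open>e\<close> will be a power of two.\<close>

lemma fraction_less_iff:
  fixes p m p1 m1 p2 m2 :: real
  assumes "0 < d" "0 < d1" "0 < d2" "0 < e"
  shows "(p1 - m1) / d1 + (p2 - m2) / d2 + inverse e < (p - m) / d \<longleftrightarrow>
    p1 * d2 * d * e + p2 * d1 * d * e + d1 * d2 * d + m * d1 * d2 * e <
    p * d1 * d2 * e + m1 * d2 * d * e + m2 * d1 * d * e"
proof -
  have "(p1 - m1) / d1 + (p2 - m2) / d2 + inverse e < (p - m) / d \<longleftrightarrow>
    ((p1 - m1) / d1 + (p2 - m2) / d2 + inverse e) * (d1 * d2 * d * e) < (p - m) / d * (d1 * d2 * d * e)"
    using assms by (intro mult_less_cancel_right_pos[symmetric]) simp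
  also have "((p1 - m1) / d1 + (p2 - m2) / d2 + inverse e) * (d1 * d2 * d * e)
      = (p1 - m1) * d2 * d * e + (p2 - m2) * d1 * d * e + d1 * d2 * d"
    using assms by (simp add: field_simps)
  also have "(p - m) / d * (d1 * d2 * d * e) = (p - m) * d1 * d2 * e"
    using assms by (simp add: field_simps)
  finally show ?thesis by (simp add: algebra_simps)
qed

lemma computable_pred_rat_margin:
  assumes "computable_nat k c" "computable_nat k c1" "computable_nat k c2" "computable_nat k s"
  shows "computable_pred k (\<lambda>xs. real_of_rat (rat_dec (c1 xs)) + real_of_rat (rat_dec (c2 xs))
     + inverse (2 ^ s xs) < real_of_rat (rat_dec (c xs)))"
proof -
  let ?A = "\<lambda>xs. pos_code (c1 xs) * den_code (c2 xs) * den_code (c xs) * 2 ^ s xs +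
      pos_code (c2 xs) * den_code (c1 xs) * den_code (c xs) * 2 ^ s xs +
      den_code (c1 xs) * den_code (c2 xs) * den_code (c xs) +
      neg_code (c xs) * den_code (c1 xs) * den_code (c2 xs) * 2 ^ s xs"
  let ?B = "\<lambda>xs. pos_code (c xs) * den_code (c1 xs) * den_code (c2 xs) * 2 ^ s xs +
      neg_code (c1 xs) * den_code (c2 xs) * den_code (c xs) * 2 ^ s xs +
      neg_code (c2 xs) * den_code (c1 xs) * den_code (c xs) * 2 ^ s xs"
  have c: "computable_pred k (\<lambda>xs. ?A xs < ?B xs)"
    by (intro computable_pred_less computable_nat_add computable_nat_mult computable_nat_code
        computable_nat_power2 assms)
  have pos: "0 < real (den_code n)" for n by (simp add: den_code_def)
  show ?thesis
  proof (rule computable_pred_cong[OF c])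
    fix xs
    have "?A xs < ?B xs \<longleftrightarrow> real (?A xs) < real (?B xs)" by (rule of_nat_less_iff[symmetric])
    also have "\<dots> \<longleftrightarrow> real_of_rat (rat_dec (c1 xs)) + real_of_rat (rat_dec (c2 xs))
     + inverse (2 ^ s xs) < real_of_rat (rat_dec (c xs))"
      unfolding rat_dec_eq using fraction_less_iff[OF pos pos pos, of "2 ^ s xs"] by simp
    finally show "(real_of_rat (rat_dec (c1 xs)) + real_of_rat (rat_dec (c2 xs))
     + inverse (2 ^ s xs) < real_of_rat (rat_dec (c xs))) \<longleftrightarrow> ?A xs < ?B xs" ..
  qed
qed

text \<open>The witness is a precision at which the approximation exceeds the threshold by more than
  its error bound; any precision finer than half the gap serves. The threshold has two summands
  because it will be a sum of two radii.\<close>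

lemma semidec_less_computable_real:
  assumes g: "computable_real k g" and c1: "computable_nat k c1" and c2: "computable_nat k c2"
  shows "semidec k (\<lambda>xs. real_of_rat (rat_dec (c1 xs)) + real_of_rat (rat_dec (c2 xs)) < g xs)"
proof -
  obtain G where G: "computable_rat (Suc k) G"
    "\<And>xs i. length xs = k \<Longrightarrow> \<bar>g xs - real_of_rat (G (xs @ [i]))\<bar> < inverse (2 ^ i)"
    using g unfolding computable_real_def by blast
  obtain c where c: "computable_nat (Suc k) c" "\<And>xs. length xs = Suc k \<Longrightarrow> rat_dec (c xs) = G xs"
    using G(1) unfolding computable_rat_def by blast
  let ?P = "\<lambda>zs. real_of_rat (rat_dec (c1 (tl zs))) + real_of_rat (rat_dec (c2 (tl zs)))
      + inverse (2 ^ hd zs) < real_of_rat (rat_dec (c (tl zs @ [hd zs])))"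
  have "computable_nat (Suc k) (\<lambda>zs. c (tl zs @ [hd zs]))"
  proof (rule computable_nat_list[OF c(1)])
    show "computable_nat (Suc k) (\<lambda>zs. (tl zs @ [hd zs]) ! i)" if "i < Suc k" for i
    proof (cases "i < k")
      case True
      show ?thesis
        by (rule computable_nat_cong[OF computable_nat_nth_Suc_tl[OF True]])
          (use True in \<open>auto simp: nth_append\<close>)
    next
      case False
      then show ?thesis
        using that by (intro computable_nat_cong[OF computable_nat_hd]) (auto simp: nth_append)
    qed
  qed auto
  then have P: "computable_pred (Suc k) ?P"
    by (intro computable_pred_rat_margin computable_nat_tl c1 c2 computable_nat_hd)
  show ?thesis
  proof (rule semidecI[OF P])
    fix xs :: "nat list" assume len: "length xs = k"
    let ?r = "real_of_rat (rat_dec (c1 xs)) + real_of_rat (rat_dec (c2 xs))"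
    have G': "\<bar>g xs - real_of_rat (rat_dec (c (xs @ [i])))\<bar> < inverse (2 ^ i)" for i
      using G(2)[OF len] c(2) len by simp
    show "?r < g xs \<longleftrightarrow> (\<exists>w. ?P (w # xs))"
    proof
      assume "?r < g xs"
      then obtain i where i: "inverse (2 ^ i) < (g xs - ?r) / 2"
        using real_arch_pow_inv[of "(g xs - ?r) / 2" "1/2"]
        by (auto simp: field_simps power_one_over)
      then have "?P (i # xs)" using G'[of i] by simp
      then show "\<exists>w. ?P (w # xs)" ..
    next
      assume "\<exists>w. ?P (w # xs)"
      then obtain w where "?P (w # xs)" ..
      then show "?r < g xs" using G'[of w] by simp
    qed
  qed
qed


section \<open>Rational balls\<close>

lemma computable_pred_pair_mem:
  assumes "finite R" "computable_nat k f" "computable_nat k g"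
  shows "computable_pred k (\<lambda>xs. (f xs, g xs) \<in> R)"
proof -
  have c: "computable_pred k (\<lambda>xs. \<exists>p\<in>R. f xs = fst p \<and> g xs = snd p)"
    by (intro computable_pred_finite_bex computable_pred_conj computable_pred_eq
        computable_nat_const assms)
  show ?thesis by (rule computable_pred_cong[OF c]) force
qed

locale computable_space = Metric_space X d
  for X :: "'a set" and d :: "'a \<Rightarrow> 'a \<Rightarrow> real" +
  fixes \<alpha> :: "nat \<Rightarrow> 'a" and q :: "nat \<Rightarrow> rat" and \<tau>1 \<tau>2 :: "nat \<Rightarrow> nat"
    and \<sigma> :: "nat \<Rightarrow> nat \<Rightarrow> nat" and \<eta> :: "nat \<Rightarrow> nat"
  assumes space: "computable_metric_space X d \<alpha>" and enums: "standard_enums q \<tau>1 \<tau>2 \<sigma> \<eta>"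
begin

abbreviation center :: "nat \<Rightarrow> 'a" where "center a \<equiv> \<alpha> (\<tau>1 a)"
abbreviation radius :: "nat \<Rightarrow> real" where "radius a \<equiv> real_of_rat (q (\<tau>2 a))"
abbreviation rball :: "nat \<Rightarrow> 'a set" where "rball a \<equiv> ratball X d \<alpha> q \<tau>1 \<tau>2 a"
abbreviation runion :: "nat \<Rightarrow> 'a set" where "runion j \<equiv> ratunion X d \<alpha> q \<tau>1 \<tau>2 \<sigma> \<eta> j"

text \<open>Formal disjointness. It depends on centers and radii alone, is semidecidable, and
  implies disjointness of the balls by the triangle inequality.\<close>

definition apart :: "nat \<Rightarrow> nat \<Rightarrow> bool" where
  "apart a b \<longleftrightarrow> radius a + radius b < d (center a) (center b)"

lemma center_in_space: "center a \<in> X"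
  using space unfolding computable_metric_space_def by auto

lemma in_rball: "x \<in> rball a \<longleftrightarrow> x \<in> X \<and> d (center a) x < radius a"
  by (auto simp: ratball_def in_mball center_in_space)

lemma runion_eq: "runion j = (\<Union>k\<le>\<eta> j. rball (\<sigma> j k))"
  by (auto simp: ratunion_def)

lemma openin_rball: "openin mtopology (rball a)"
  by (simp add: ratball_def)

lemma computable_nat_enums:
  "computable_nat k f \<Longrightarrow> computable_nat k (\<lambda>xs. \<tau>1 (f xs))"
  "computable_nat k f \<Longrightarrow> computable_nat k (\<lambda>xs. \<tau>2 (f xs))"
  "computable_nat k f \<Longrightarrow> computable_nat k (\<lambda>xs. \<eta> (f xs))"
  "computable_nat k f \<Longrightarrow> computable_nat k g \<Longrightarrow> computable_nat k (\<lambda>xs. \<sigma> (f xs) (g xs))"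
  using enums unfolding standard_enums_def
  by (auto intro: computable_nat_comp1 computable_nat_comp2)

lemma computable_real_centers:
  "computable_real 2 (\<lambda>xs. d (center (xs ! 0)) (center (xs ! 1)))"
proof -
  have "computable_real 2 (\<lambda>xs. d (\<alpha> (xs ! 0)) (\<alpha> (xs ! 1)))"
    using space unfolding computable_metric_space_def by blast
  then obtain G c where G: "\<And>xs i. length xs = 2 \<Longrightarrow>
      \<bar>d (\<alpha> (xs ! 0)) (\<alpha> (xs ! 1)) - real_of_rat (G (xs @ [i]))\<bar> < inverse (2 ^ i)"
    and c: "computable_nat (Suc 2) c" "\<And>xs. length xs = Suc 2 \<Longrightarrow> rat_dec (c xs) = G xs"
    unfolding computable_real_def computable_rat_def by blast
  have "computable_nat (Suc 2) (\<lambda>xs. c [\<tau>1 (xs ! 0), \<tau>1 (xs ! 1), xs ! 2])"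
    by (rule computable_nat_list[OF c(1)])
      (auto intro!: computable_nat_nth_Cons computable_nat_enums computable_nat_proj)
  then have "computable_rat (Suc 2) (\<lambda>xs. G [\<tau>1 (xs ! 0), \<tau>1 (xs ! 1), xs ! 2])"
    unfolding computable_rat_def using c(2) by (intro exI conjI) auto
  moreover have "\<bar>d (center (xs ! 0)) (center (xs ! 1)) -
      real_of_rat (G [\<tau>1 ((xs @ [i]) ! 0), \<tau>1 ((xs @ [i]) ! 1), (xs @ [i]) ! 2])\<bar> < inverse (2 ^ i)"
    if "length xs = 2" for xs i
    using G[of "[\<tau>1 (xs ! 0), \<tau>1 (xs ! 1)]" i] that by (simp add: nth_append)
  ultimately show ?thesis unfolding computable_real_def by blast
qed

lemma semidec_apart:
  assumes "computable_nat k f" "computable_nat k g"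
  shows "semidec k (\<lambda>xs. apart (f xs) (g xs))"
proof -
  obtain c where c: "computable_nat 1 c" "\<And>xs. length xs = 1 \<Longrightarrow> rat_dec (c xs) = q (xs ! 0)"
    using enums unfolding standard_enums_def computable_rat_def by blast
  have c': "computable_nat 2 (\<lambda>xs. c [\<tau>2 (xs ! i)])" if "i < 2" for i
    using that by (intro computable_nat_list[OF c(1)])
      (auto intro!: computable_nat_nth_Cons computable_nat_enums computable_nat_proj)
  have "semidec 2 (\<lambda>xs. real_of_rat (rat_dec (c [\<tau>2 (xs ! 0)])) +
      real_of_rat (rat_dec (c [\<tau>2 (xs ! 1)])) < d (center (xs ! 0)) (center (xs ! 1)))"
    by (intro semidec_less_computable_real computable_real_centers c') auto
  then have "semidec 2 (\<lambda>xs. apart (xs ! 0) (xs ! 1))"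
    by (simp add: apart_def c(2))
  moreover have "computable_nat k (\<lambda>xs. [f xs, g xs] ! i)" if "i < 2" for i
    using that assms by (auto intro!: computable_nat_nth_Cons)
  ultimately show ?thesis
    using semidec_list[of 2 _ k "\<lambda>xs. [f xs, g xs]"] by fastforce
qed

lemma apart_disjoint: "apart a b \<Longrightarrow> x \<in> rball a \<Longrightarrow> x \<notin> rball b"
  using triangle[of "center a" x "center b"] commute[of "center b" x] center_in_space
  unfolding apart_def in_rball by fastforce

lemma exists_small_rball:
  assumes "x \<in> X" "0 < r"
  obtains a where "x \<in> rball a" "radius a < r"
proof -
  obtain e :: rat where e: "0 < real_of_rat e" "real_of_rat e < r"
    using of_rat_dense[OF assms(2)] by blast
  have "mtopology closure_of range \<alpha> = X"
    using space unfolding computable_metric_space_def by blast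
  then have "x \<in> mtopology closure_of range \<alpha>" using assms(1) by simp
  then have "\<forall>T. x \<in> T \<and> openin mtopology T \<longrightarrow> (\<exists>y. y \<in> range \<alpha> \<and> y \<in> T)"
    unfolding in_closure_of by (rule conjunct2)
  moreover have "x \<in> mball x (real_of_rat e)" using e(1) assms(1) by simp
  ultimately obtain i where i: "\<alpha> i \<in> mball x (real_of_rat e)"
    using openin_mball[of x "real_of_rat e"] by blast
  have "e \<in> range q"
    using enums e(1) unfolding standard_enums_def by simp
  then obtain m where m: "q m = e" by blast
  have "(i, m) \<in> range (\<lambda>i. (\<tau>1 i, \<tau>2 i))"
    using enums unfolding standard_enums_def by simp
  then obtain a where a: "\<tau>1 a = i" "\<tau>2 a = m" by blast
  have "x \<in> rball a"
    using i by (auto simp: in_rball a m in_mball commute)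
  moreover have "radius a < r" using e by (simp add: a m)
  ultimately show ?thesis by (rule that)
qed

text \<open>Requiring the balls to meet \<open>K\<close> keeps their centers within \<open>r\<close> of \<open>K\<close>; that is what
  makes balls near distant compact sets formally apart.\<close>
lemma small_rball_cover:
  assumes K: "compactin mtopology K" and "0 < r"
  shows "\<exists>A. finite A \<and> K \<subseteq> (\<Union>a\<in>A. rball a) \<and> (\<forall>a\<in>A. radius a < r \<and> rball a \<inter> K \<noteq> {})"
proof -
  let ?N = "{a. radius a < r \<and> rball a \<inter> K \<noteq> {}}"
  have "K \<subseteq> X" using K compactin_subset_topspace by fastforce
  have "K \<subseteq> \<Union>(rball ` ?N)"
  proof
    fix x assume "x \<in> K"
    with \<open>K \<subseteq> X\<close> obtain a where "x \<in> rball a" "radius a < r"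
      using exists_small_rball[OF _ \<open>0 < r\<close>] by blast
    with \<open>x \<in> K\<close> show "x \<in> \<Union>(rball ` ?N)" by blast
  qed
  then obtain \<F> where "finite \<F>" "\<F> \<subseteq> rball ` ?N" "K \<subseteq> \<Union>\<F>"
    using compactinD[OF K, of "rball ` ?N"] openin_rball by blast
  then obtain A where "A \<subseteq> ?N" "finite A" "\<F> = rball ` A"
    using finite_subset_image[of \<F> rball ?N] by blast
  with \<open>K \<subseteq> \<Union>\<F>\<close> show ?thesis by (intro exI[of _ A]) auto
qed

text \<open>Passing from the points of \<open>K\<close> and \<open>L\<close> to the centers costs
  less than \<open>r\<close> on each side. So the centers are more than \<open>2 * r\<close> apart,
  which exceeds the sum of the radii.\<close>

lemma apart_near:
  assumes "\<And>x y. x \<in> K \<Longrightarrow> y \<in> L \<Longrightarrow> 4 * r \<le> d x y"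
    and "radius a < r" "rball a \<inter> K \<noteq> {}" "radius b < r" "rball b \<inter> L \<noteq> {}"
  shows "apart a b"
proof -
  obtain x y where xy: "x \<in> rball a" "x \<in> K" "y \<in> rball b" "y \<in> L" using assms(3,5) by blast
  have "4 * r \<le> d x y" using assms(1) xy by blast
  moreover have "d x y \<le> d x (center a) + d (center a) y"
    using xy by (intro triangle) (auto simp: in_rball center_in_space)
  moreover have "d (center a) y \<le> d (center a) (center b) + d (center b) y"
    using xy by (intro triangle) (auto simp: in_rball center_in_space)
  ultimately show ?thesis
    using assms(2,4) xy commute[of x "center a"] unfolding apart_def in_rball by linarith
qed

text \<open>A Lebesgue number argument: \<open>y\<close> stays \<open>2 * e z\<close> away from a
  center \<open>z\<close> that is within \<open>e z\<close> of \<open>x\<close>, and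
  \<open>4 * r < e z\<close>. The form with \<open>at_right 0\<close> lets finitely many conditions
  on \<open>r\<close> be imposed together.\<close>

lemma compactin_disjoint_separated:
  assumes K: "compactin mtopology K" and L: "compactin mtopology L" and KL: "K \<inter> L = {}"
  shows "\<forall>\<^sub>F r in at_right 0. \<forall>x\<in>K. \<forall>y\<in>L. 4 * r \<le> d x y"
proof -
  have sub: "K \<subseteq> X" "L \<subseteq> X" using K L compactin_subset_topspace by fastforce+
  have "openin mtopology (X - L)"
    using compactin_imp_closedin[OF Hausdorff_space_mtopology L] by (simp add: closedin_def)
  then have "\<exists>e>0. mball x (2 * e) \<subseteq> X - L" if "x \<in> K" for x
    using that KL sub unfolding openin_mtopology
    by (metis Diff_iff IntI empty_iff field_sum_of_halves mult_2 half_gt_zero subsetD)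
  then obtain e where e: "\<And>x. x \<in> K \<Longrightarrow> 0 < e x \<and> mball x (2 * e x) \<subseteq> X - L" by metis
  have "K \<subseteq> \<Union>((\<lambda>x. mball x (e x)) ` K)" using e sub by auto
  then obtain \<F> where "finite \<F>" "\<F> \<subseteq> (\<lambda>x. mball x (e x)) ` K" "K \<subseteq> \<Union>\<F>"
    using compactinD[OF K, of "(\<lambda>x. mball x (e x)) ` K"] openin_mball by blast
  then obtain A where A: "A \<subseteq> K" "finite A" "K \<subseteq> (\<Union>x\<in>A. mball x (e x))"
    using finite_subset_image[of \<F> "\<lambda>x. mball x (e x)" K] by blast
  have "\<forall>\<^sub>F r in at_right 0. \<forall>x\<in>A. r < e x / 4"
  proof (intro eventually_ball_finite ballI)
    show "\<forall>\<^sub>F r in at_right 0. r < e x / 4" if "x \<in> A" for x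
      using e[of x] A that by (intro order_tendstoD(2)[OF tendsto_ident_at]) auto
  qed (rule A)
  then show ?thesis
  proof eventually_elim
    case (elim r)
    show ?case
    proof (intro ballI)
      fix x y assume xy: "x \<in> K" "y \<in> L"
      then obtain z where z: "z \<in> A" "x \<in> mball z (e z)" using A by blast
      then have "mball z (2 * e z) \<subseteq> X - L" using e A(1) by blast
      then have "y \<notin> mball z (2 * e z)" using xy by blast
      then have "2 * e z \<le> d z y" using z xy sub by (auto simp: in_mball)
      also have "\<dots> \<le> d z x + d x y" using z xy sub by (intro triangle) (auto simp: in_mball)
      finally show "4 * r \<le> d x y" using z elim by (auto simp: in_mball)
    qed
  qed
qed

text \<open>The code reproduces the list position by position and not merely its set of entries; a
  list of balls and the list of their colours can thus be coded separately and stay aligned.\<close>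

lemma exists_code:
  assumes "l \<noteq> []"
  shows "\<exists>j. \<eta> j = length l - 1 \<and> (\<forall>k\<le>\<eta> j. \<sigma> j k = l ! k) \<and> \<sigma> j ` {..\<eta> j} = set l"
proof -
  obtain j where j: "map (\<sigma> j) [0..<Suc (\<eta> j)] = l"
    using enums assms unfolding standard_enums_def by (metis (mono_tags, lifting) mem_Collect_eq rangeE)
  have "\<eta> j = length l - 1" using arg_cong[OF j, of length] by simp
  moreover have "\<sigma> j k = l ! k" if "k \<le> \<eta> j" for k
    using that by (subst j[symmetric]) (simp del: upt_Suc)
  moreover have "\<sigma> j ` {..\<eta> j} = set l"
    by (subst j[symmetric]) (simp del: upt_Suc add: atLeast0LessThan lessThan_Suc_atMost)
  ultimately show ?thesis by blast
qed

lemma semidec_mem: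
  assumes "ce_set A" "computable_nat k f"
  shows "semidec k (\<lambda>xs. f xs \<in> A)"
  using semidec_list[OF assms(1)[unfolded ce_set_iff_semidec], of k "\<lambda>xs. [f xs]"] assms(2) by simp

text \<open>The code \<open>c\<close> lists colours of the balls of the cover coded by \<open>j\<close>; colour 0 marks balls
  from \<open>F\<close>, colour 1 the ball \<open>i\<close> itself, and \<open>Col\<close> holds the signed coordinates. The code \<open>j'\<close>
  stands for a cover of the boundary, which the balls of colour \<open>z\<close> must avoid.\<close>
definition coloured_cover ::
  "nat set \<Rightarrow> (nat \<times> nat) set \<Rightarrow> nat set \<Rightarrow> (nat \<times> nat) set \<Rightarrow> nat \<Rightarrow> nat \<Rightarrow> nat \<Rightarrow> nat \<Rightarrow> nat \<Rightarrow> bool" where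
  "coloured_cover F W Col Opp z i j c j' \<longleftrightarrow> (\<forall>k\<le>\<eta> j.
     (\<sigma> c k = 0 \<and> \<sigma> j k \<in> F \<or> \<sigma> c k = 1 \<and> \<sigma> j k = i \<or> \<sigma> c k \<in> Col) \<and>
     (\<forall>l\<le>\<eta> j. (\<sigma> c k, \<sigma> c l) \<notin> Opp \<or> apart (\<sigma> j k) (\<sigma> j l)) \<and>
     (\<forall>w\<in>W. (\<sigma> c k, snd w) \<notin> Opp \<or> apart (\<sigma> j k) (fst w)) \<and>
     (\<sigma> c k \<noteq> z \<or> (\<forall>l\<le>\<eta> j'. \<sigma> j' l \<in> F \<or> \<sigma> j' l = i \<or> apart (\<sigma> j k) (\<sigma> j' l))))"

text \<open>Formal disjointness and membership in \<open>A\<close> and \<open>B\<close> are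
  semidecidable, the other conditions are decidable, and the fixed sets are finite; so only bounded
  and existential quantifiers remain.\<close>

lemma ce_set_coloured_cover:
  assumes fin: "finite F" "finite W" "finite Col" "finite Opp" and A: "ce_set A" "ce_set B"
  shows "ce_set {i. \<exists>j c j'. j \<in> A \<and> j' \<in> B \<and> coloured_cover F W Col Opp z i j c j'}"
proof -
  \<comment> \<open>The argument list is \<open>[j', c, j, i]\<close>. The quantifier over
    \<open>k\<close> adds an entry in front, the one over \<open>l\<close> another, and each shifts
    the indices by one; the existential quantifiers finally strip \<open>j'\<close>,
    \<open>c\<close> and \<open>j\<close> from the head.\<close>
  note computable = computable_nat_enums computable_nat_proj computable_nat_const
  have 1: "semidec 5 (\<lambda>xs. \<sigma> (xs ! 2) (xs ! 0) = 0 \<and> \<sigma> (xs ! 3) (xs ! 0) \<in> F \<or>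
      \<sigma> (xs ! 2) (xs ! 0) = 1 \<and> \<sigma> (xs ! 3) (xs ! 0) = xs ! 4 \<or> \<sigma> (xs ! 2) (xs ! 0) \<in> Col)"
    by (intro semidec_computable_pred computable_pred_disj computable_pred_conj computable_pred_eq
        computable_pred_mem fin computable) auto
  have "semidec (Suc 5) (\<lambda>xs. (\<sigma> (xs ! 3) (xs ! 1), \<sigma> (xs ! 3) (xs ! 0)) \<notin> Opp \<or>
      apart (\<sigma> (xs ! 4) (xs ! 1)) (\<sigma> (xs ! 4) (xs ! 0)))"
    by (intro semidec_disj semidec_computable_pred computable_pred_not computable_pred_pair_mem
        semidec_apart fin computable) auto
  from semidec_ball[OF this, of "\<lambda>xs. \<eta> (xs ! 3)"]
  have 2: "semidec 5 (\<lambda>xs. \<forall>l\<le>\<eta> (xs ! 3). (\<sigma> (xs ! 2) (xs ! 0), \<sigma> (xs ! 2) l) \<notin> Opp \<or>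
      apart (\<sigma> (xs ! 3) (xs ! 0)) (\<sigma> (xs ! 3) l))"
    by (simp add: computable)
  have 3: "semidec 5 (\<lambda>xs. \<forall>w\<in>W. (\<sigma> (xs ! 2) (xs ! 0), snd w) \<notin> Opp \<or>
      apart (\<sigma> (xs ! 3) (xs ! 0)) (fst w))"
    by (intro semidec_finite_ball semidec_disj semidec_computable_pred computable_pred_not
        computable_pred_pair_mem semidec_apart fin computable) auto
  have "semidec (Suc 5) (\<lambda>xs. \<sigma> (xs ! 2) (xs ! 0) \<in> F \<or> \<sigma> (xs ! 2) (xs ! 0) = xs ! 5 \<or>
      apart (\<sigma> (xs ! 4) (xs ! 1)) (\<sigma> (xs ! 2) (xs ! 0)))"
    by (intro semidec_disj semidec_computable_pred computable_pred_mem computable_pred_eq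
        semidec_apart fin computable) auto
  from semidec_ball[OF this, of "\<lambda>xs. \<eta> (xs ! 1)"]
  have 4: "semidec 5 (\<lambda>xs. \<forall>l\<le>\<eta> (xs ! 1). \<sigma> (xs ! 1) l \<in> F \<or> \<sigma> (xs ! 1) l = xs ! 4 \<or>
      apart (\<sigma> (xs ! 3) (xs ! 0)) (\<sigma> (xs ! 1) l))"
    by (simp add: computable)
  have 5: "semidec 5 (\<lambda>xs. \<sigma> (xs ! 2) (xs ! 0) \<noteq> z)"
    by (intro semidec_computable_pred computable_pred_not computable_pred_eq computable) auto
  have "semidec (Suc 4) (\<lambda>xs.
     (\<sigma> (xs ! 2) (xs ! 0) = 0 \<and> \<sigma> (xs ! 3) (xs ! 0) \<in> F \<or>
      \<sigma> (xs ! 2) (xs ! 0) = 1 \<and> \<sigma> (xs ! 3) (xs ! 0) = xs ! 4 \<or> \<sigma> (xs ! 2) (xs ! 0) \<in> Col) \<and>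
     (\<forall>l\<le>\<eta> (xs ! 3). (\<sigma> (xs ! 2) (xs ! 0), \<sigma> (xs ! 2) l) \<notin> Opp \<or>
      apart (\<sigma> (xs ! 3) (xs ! 0)) (\<sigma> (xs ! 3) l)) \<and>
     (\<forall>w\<in>W. (\<sigma> (xs ! 2) (xs ! 0), snd w) \<notin> Opp \<or> apart (\<sigma> (xs ! 3) (xs ! 0)) (fst w)) \<and>
     (\<sigma> (xs ! 2) (xs ! 0) \<noteq> z \<or> (\<forall>l\<le>\<eta> (xs ! 1). \<sigma> (xs ! 1) l \<in> F \<or> \<sigma> (xs ! 1) l = xs ! 4 \<or>
      apart (\<sigma> (xs ! 3) (xs ! 0)) (\<sigma> (xs ! 1) l))))"
    using semidec_conj[OF 1 semidec_conj[OF 2 semidec_conj[OF 3 semidec_disj[OF 5 4]]]] by simp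
  from semidec_ball[OF this, of "\<lambda>xs. \<eta> (xs ! 2)"]
  have "semidec 4 (\<lambda>xs. coloured_cover F W Col Opp z (xs ! 3) (xs ! 2) (xs ! 1) (xs ! 0))"
    unfolding coloured_cover_def by (simp add: computable)
  then have "semidec 4 (\<lambda>xs. xs ! 2 \<in> A \<and> xs ! 0 \<in> B \<and>
      coloured_cover F W Col Opp z (xs ! 3) (xs ! 2) (xs ! 1) (xs ! 0))"
    by (intro semidec_conj semidec_mem A computable) auto
  then have "semidec (Suc 3) (\<lambda>xs. xs ! 2 \<in> A \<and> xs ! 0 \<in> B \<and>
      coloured_cover F W Col Opp z (xs ! 3) (xs ! 2) (xs ! 1) (xs ! 0))" by simp
  from semidec_ex[OF this]
  have "semidec (Suc 2) (\<lambda>xs. \<exists>j'. xs ! 1 \<in> A \<and> j' \<in> B \<and>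
      coloured_cover F W Col Opp z (xs ! 2) (xs ! 1) (xs ! 0) j')" by (simp add: numeral_2_eq_2 numeral_3_eq_3)
  from semidec_ex[OF this]
  have "semidec (Suc 1) (\<lambda>xs. \<exists>c j'. xs ! 0 \<in> A \<and> j' \<in> B \<and>
      coloured_cover F W Col Opp z (xs ! 1) (xs ! 0) c j')" by (simp add: numeral_2_eq_2)
  from semidec_ex[OF this] show ?thesis
    unfolding ce_set_iff_semidec by simp
qed

end


section \<open>Covers of a cube\<close>

definition coord_box :: "nat \<Rightarrow> (nat \<Rightarrow> real) \<Rightarrow> (nat \<Rightarrow> real) \<Rightarrow> (nat \<Rightarrow> real) set" where
  "coord_box n a b = {u. (\<forall>t<n. a t \<le> u t \<and> u t \<le> b t) \<and> (\<forall>t\<ge>n. u t = 0)}"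

text \<open>Tychonoff, with the one-point factor 0 for all coordinates from \<open>n\<close>
  on.\<close>

lemma compact_coord_box: "compact (coord_box n a b)"
proof -
  have "compactin (powertop_real UNIV) (PiE UNIV (\<lambda>t. if t < n then {a t..b t} else {0}))"
    unfolding compactin_PiE by (auto simp: compactin_euclidean_iff)
  moreover have "PiE UNIV (\<lambda>t. if t < n then {a t..b t} else {0}) = coord_box n a b"
    by (auto simp: coord_box_def PiE_iff split: if_splits)
  ultimately show ?thesis
    by (simp add: euclidean_product_topology)
qed

lemma tendsto_funI:
  fixes f :: "'b \<Rightarrow> nat \<Rightarrow> real"
  assumes "\<And>i. ((\<lambda>m. f m i) \<longlongrightarrow> l i) F"
  shows "(f \<longlongrightarrow> l) F"
proof -
  have "limitin (powertop_real UNIV) f l F"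
    unfolding limitin_componentwise using assms by auto
  then show ?thesis by (simp add: euclidean_product_topology)
qed

lemma tendsto_fun_nth:
  fixes f :: "'b \<Rightarrow> nat \<Rightarrow> real"
  assumes "(f \<longlongrightarrow> l) F"
  shows "((\<lambda>m. f m i) \<longlongrightarrow> l i) F"
proof -
  have "limitin (powertop_real UNIV) f l F"
    using assms by (simp add: euclidean_product_topology)
  then show ?thesis unfolding limitin_componentwise by simp
qed

text \<open>A form of the Poincare-Miranda theorem; the discrete input is Kuhn's lemma on grids.\<close>
lemma cube_covering:
  fixes U V :: "nat \<Rightarrow> (nat \<Rightarrow> real) set" and n :: nat
  defines "Q \<equiv> coord_box n (\<lambda>_. 0) (\<lambda>_. 1)"
  assumes opn: "\<And>t. t < n \<Longrightarrow> openin (top_of_set Q) (U t)" "\<And>t. t < n \<Longrightarrow> openin (top_of_set Q) (V t)"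
    and cover: "Q \<subseteq> (\<Union>t<n. U t \<union> V t)"
    and disj: "\<And>t. t < n \<Longrightarrow> U t \<inter> V t = {}"
    and face0: "\<And>t u. t < n \<Longrightarrow> u \<in> U t \<Longrightarrow> u t \<noteq> 0"
    and face1: "\<And>t u. t < n \<Longrightarrow> u \<in> V t \<Longrightarrow> u t \<noteq> 1"
  shows False
proof -
  define pt where "pt m x = (\<lambda>t. if t < n then real (x t) / real (Suc m) else 0)" for m and x :: "nat \<Rightarrow> nat"
  \<comment> \<open>The second disjunct enforces label 1 on the face of coordinate value 1, as
    Kuhn's lemma requires; label 0 on the opposite face follows from \<open>face0\<close>.\<close>
  define lab where "lab m x t = (if pt m x \<in> U t \<or> x t = Suc m then 1 else 0 :: nat)" for m x t
  have pt_Q: "pt m x \<in> Q" if "\<forall>t<n. x t \<le> Suc m" for m x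
    using that by (auto simp: Q_def coord_box_def pt_def)
  have "\<forall>m. \<exists>q. (\<forall>t<n. q t < Suc m) \<and> (\<forall>t<n. \<exists>r s. (\<forall>j<n. q j \<le> r j \<and> r j \<le> q j + 1) \<and>
      (\<forall>j<n. q j \<le> s j \<and> s j \<le> q j + 1) \<and> lab m r t \<noteq> lab m s t)"
  proof
    fix m
    have k0: "\<forall>x. (\<forall>i<n. x i \<le> Suc m) \<longrightarrow> (\<forall>i<n. x i = 0 \<longrightarrow> lab m x i = 0)"
    proof (intro allI impI)
      fix x :: "nat \<Rightarrow> nat" and i assume "i < n" "x i = 0"
      then have "pt m x i = 0" by (simp add: pt_def)
      with face0[OF \<open>i < n\<close>] have "pt m x \<notin> U i" by blast
      with \<open>x i = 0\<close> show "lab m x i = 0" by (simp add: lab_def)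
    qed
    have k1: "\<forall>x. (\<forall>i<n. x i \<le> Suc m) \<longrightarrow> (\<forall>i<n. lab m x i = 0 \<or> lab m x i = 1)"
      and k2: "\<forall>x. (\<forall>i<n. x i \<le> Suc m) \<longrightarrow> (\<forall>i<n. x i = Suc m \<longrightarrow> lab m x i = 1)"
      by (simp_all add: lab_def)
    obtain q where "\<forall>i<n. q i < Suc m" "\<forall>i<n. \<exists>r s. (\<forall>j<n. q j \<le> r j \<and> r j \<le> q j + 1) \<and>
      (\<forall>j<n. q j \<le> s j \<and> s j \<le> q j + 1) \<and> lab m r i \<noteq> lab m s i"
      by (rule kuhn_lemma[OF zero_less_Suc k1 k0 k2])
    then show "\<exists>q. (\<forall>t<n. q t < Suc m) \<and> (\<forall>t<n. \<exists>r s. (\<forall>j<n. q j \<le> r j \<and> r j \<le> q j + 1) \<and>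
      (\<forall>j<n. q j \<le> s j \<and> s j \<le> q j + 1) \<and> lab m r t \<noteq> lab m s t)"
      by (intro exI[of _ q] conjI)
  qed
  from choice[OF this] obtain q where q: "\<And>m t. t < n \<Longrightarrow> q m t < Suc m"
    "\<And>m t. t < n \<Longrightarrow> \<exists>r s. (\<forall>j<n. q m j \<le> r j \<and> r j \<le> q m j + 1) \<and>
      (\<forall>j<n. q m j \<le> s j \<and> s j \<le> q m j + 1) \<and> lab m r t \<noteq> lab m s t" by blast
  have qQ: "\<forall>m. pt m (q m) \<in> Q" using q(1) by (intro allI pt_Q impI less_imp_le) auto
  have scQ: "seq_compact Q"
    unfolding Q_def by (intro compact_imp_seq_compact compact_coord_box)
  obtain l \<phi> where l: "l \<in> Q" "strict_mono \<phi>" "((\<lambda>m. pt m (q m)) \<circ> \<phi>) \<longlonglongrightarrow> l"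
    by (rule seq_compactE[OF scQ qQ])
  \<comment> \<open>Corners of the grid cell at \<open>q m\<close> differ from it by at most
    \<open>1 / Suc m\<close> in each coordinate, so every choice of corners converges to the same
    limit along \<phi>.\<close>
  have lim: "((\<lambda>m. pt (\<phi> m) (r (\<phi> m))) \<longlonglongrightarrow> l)"
    if r: "\<And>m j. j < n \<Longrightarrow> q m j \<le> r m j \<and> r m j \<le> q m j + 1" for r
  proof (rule tendsto_funI)
    fix j
    have lq: "(\<lambda>m. pt (\<phi> m) (q (\<phi> m)) j) \<longlonglongrightarrow> l j"
      using tendsto_fun_nth[OF l(3)] by (simp add: o_def)
    have "(\<lambda>m. inverse (real (Suc (\<phi> m)))) \<longlonglongrightarrow> 0"
      using LIMSEQ_subseq_LIMSEQ[OF LIMSEQ_inverse_real_of_nat l(2)] by (simp add: o_def)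
    then have "(\<lambda>m. pt (\<phi> m) (q (\<phi> m)) j + inverse (real (Suc (\<phi> m)))) \<longlonglongrightarrow> l j + 0"
      by (intro tendsto_add lq)
    then have ub: "(\<lambda>m. pt (\<phi> m) (q (\<phi> m)) j + inverse (real (Suc (\<phi> m)))) \<longlonglongrightarrow> l j"
      by simp
    have 1: "pt (\<phi> m) (q (\<phi> m)) j \<le> pt (\<phi> m) (r (\<phi> m)) j" for m
      using r[of j "\<phi> m"] by (auto simp: pt_def intro!: divide_right_mono)
    have 2: "pt (\<phi> m) (r (\<phi> m)) j \<le> pt (\<phi> m) (q (\<phi> m)) j + inverse (real (Suc (\<phi> m)))" for m
    proof (cases "j < n")
      case True
      then have "real (r (\<phi> m) j) \<le> real (q (\<phi> m) j) + 1"
        using r[OF True, of "\<phi> m"] by linarith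
      then have "real (r (\<phi> m) j) / real (Suc (\<phi> m)) \<le> (real (q (\<phi> m) j) + 1) / real (Suc (\<phi> m))"
        by (rule divide_right_mono) simp
      then show ?thesis using True by (simp add: pt_def add_divide_distrib inverse_eq_divide)
    qed (simp add: pt_def)
    show "(\<lambda>m. pt (\<phi> m) (r (\<phi> m)) j) \<longlonglongrightarrow> l j"
      by (rule real_tendsto_sandwich[OF _ _ lq ub]) (simp_all only: 1 2 eventually_True)
  qed
  have ev: "\<forall>\<^sub>F m in sequentially. pt (\<phi> m) (r (\<phi> m)) \<in> W"
    if r: "\<And>m j. j < n \<Longrightarrow> q m j \<le> r m j \<and> r m j \<le> q m j + 1"
      and W: "openin (top_of_set Q) W" "l \<in> W" for r W
  proof -
    obtain O' where O': "open O'" "W = Q \<inter> O'" using W(1) by (auto simp: openin_open)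
    have "\<forall>\<^sub>F m in sequentially. pt (\<phi> m) (r (\<phi> m)) \<in> O'"
      using topological_tendstoD[OF lim[OF r] O'(1)] O'(2) W(2) by simp
    moreover have "pt m (r m) \<in> Q" for m
    proof (intro pt_Q allI impI)
      show "r m j \<le> Suc m" if "j < n" for j
        using q(1)[OF that, of m] r[OF that, of m] by linarith
    qed
    ultimately show ?thesis using O'(2) by (auto elim: eventually_mono)
  qed
  \<comment> \<open>The limit lies in \<open>U t\<close> or \<open>V t\<close> for some
    \<open>t\<close>, and eventually so do the two corners with different labels at
    \<open>t\<close>. But that label is constantly 1 on \<open>U t\<close> and, by
    \<open>disj\<close> and \<open>face1\<close>, constantly 0 on \<open>V t\<close>.\<close>
  obtain t where t: "t < n" "l \<in> U t \<or> l \<in> V t" using cover l(1) by blast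
  have "\<forall>m. \<exists>r. \<exists>s. (\<forall>j<n. q m j \<le> r j \<and> r j \<le> q m j + 1) \<and>
      (\<forall>j<n. q m j \<le> s j \<and> s j \<le> q m j + 1) \<and> lab m r t \<noteq> lab m s t"
    using q(2)[OF t(1)] by (rule allI)
  from choice[OF this] obtain r where "\<forall>m. \<exists>s. (\<forall>j<n. q m j \<le> r m j \<and> r m j \<le> q m j + 1) \<and>
      (\<forall>j<n. q m j \<le> s j \<and> s j \<le> q m j + 1) \<and> lab m (r m) t \<noteq> lab m s t" ..
  from choice[OF this] obtain s where
    "\<forall>m. (\<forall>j<n. q m j \<le> r m j \<and> r m j \<le> q m j + 1) \<and>
      (\<forall>j<n. q m j \<le> s m j \<and> s m j \<le> q m j + 1) \<and> lab m (r m) t \<noteq> lab m (s m) t" ..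
  then have rs: "\<And>m j. j < n \<Longrightarrow> q m j \<le> r m j \<and> r m j \<le> q m j + 1"
    "\<And>m j. j < n \<Longrightarrow> q m j \<le> s m j \<and> s m j \<le> q m j + 1" "\<And>m. lab m (r m) t \<noteq> lab m (s m) t"
    by blast+
  from t(2) show False
  proof
    assume "l \<in> U t"
    then have "\<forall>\<^sub>F m in sequentially. pt (\<phi> m) (r (\<phi> m)) \<in> U t" "\<forall>\<^sub>F m in sequentially. pt (\<phi> m) (s (\<phi> m)) \<in> U t"
      using ev[OF rs(1) opn(1)[OF t(1)]] ev[OF rs(2) opn(1)[OF t(1)]] by blast+
    then have "\<forall>\<^sub>F m in sequentially. lab (\<phi> m) (r (\<phi> m)) t = lab (\<phi> m) (s (\<phi> m)) t"
      by eventually_elim (simp add: lab_def)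
    with rs(3) show False by simp
  next
    assume "l \<in> V t"
    then have V: "\<forall>\<^sub>F m in sequentially. pt (\<phi> m) (r (\<phi> m)) \<in> V t" "\<forall>\<^sub>F m in sequentially. pt (\<phi> m) (s (\<phi> m)) \<in> V t"
      using ev[OF rs(1) opn(2)[OF t(1)]] ev[OF rs(2) opn(2)[OF t(1)]] by blast+
    have lab0: "lab m x t = 0" if "pt m x \<in> V t" for m x
    proof -
      have "pt m x t = real (x t) / real (Suc m)" using t(1) by (simp add: pt_def)
      with face1[OF t(1) that] have "x t \<noteq> Suc m" by auto
      with that disj[OF t(1)] show ?thesis by (auto simp: lab_def)
    qed
    from V have "\<forall>\<^sub>F m in sequentially. lab (\<phi> m) (r (\<phi> m)) t = lab (\<phi> m) (s (\<phi> m)) t"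
      by eventually_elim (simp add: lab0)
    with rs(3) show False by simp
  qed
qed


section \<open>Certificates in a chart\<close>

text \<open>The topology on sequences controls finitely many coordinates at a time; since those from
  \<open>n\<close> on vanish on \<open>C\<close>, bounds on the first \<open>n\<close> coordinates
  already describe a neighbourhood.\<close>

lemma openin_coord_nhd:
  fixes C :: "(nat \<Rightarrow> real) set"
  assumes O: "openin (top_of_set C) W" and p: "p \<in> W" and C: "\<And>v t. v \<in> C \<Longrightarrow> n \<le> t \<Longrightarrow> v t = 0"
  obtains e where "0 < e" "\<And>v. v \<in> C \<Longrightarrow> (\<And>t. t < n \<Longrightarrow> \<bar>v t - p t\<bar> < e) \<Longrightarrow> v \<in> W"
proof (rule ccontr)
  assume contr: "\<not> thesis"
  have "\<exists>v. v \<in> C \<and> (\<forall>t<n. \<bar>v t - p t\<bar> < inverse (real (Suc m))) \<and> v \<notin> W" for m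
    using contr that[of "inverse (real (Suc m))"] by fastforce
  then have "\<forall>m. \<exists>v. v \<in> C \<and> (\<forall>t<n. \<bar>v t - p t\<bar> < inverse (real (Suc m))) \<and> v \<notin> W"
    by (rule allI)
  from choice[OF this] obtain v where v: "\<And>m. v m \<in> C"
    "\<And>m t. t < n \<Longrightarrow> \<bar>v m t - p t\<bar> < inverse (real (Suc m))" "\<And>m. v m \<notin> W" by blast
  obtain G where G: "open G" "W = C \<inter> G" using O by (auto simp: openin_open)
  have "v \<longlonglongrightarrow> p"
  proof (rule tendsto_funI)
    fix t
    show "(\<lambda>m. v m t) \<longlonglongrightarrow> p t"
    proof (cases "t < n")
      case True
      have "(\<lambda>m. v m t - p t) \<longlonglongrightarrow> 0"
      proof (rule Lim_null_comparison[OF _ LIMSEQ_inverse_real_of_nat])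
        show "\<forall>\<^sub>F m in sequentially. norm (v m t - p t) \<le> inverse (real (Suc m))"
          using v(2)[OF True] by (intro always_eventually allI) (simp add: less_imp_le)
      qed
      then show ?thesis by (simp add: LIM_zero_iff)
    next
      case False
      then have "v m t = 0" "p t = 0" for m using C[OF v(1)[of m], of t] C[of p t] p G(2) by auto
      then show ?thesis by simp
    qed
  qed
  then have "\<forall>\<^sub>F m in sequentially. v m \<in> G"
    using G p by (intro topological_tendstoD) auto
  then obtain m where "v m \<in> G" using eventually_happens'[OF sequentially_bot] by blast
  then show False using v(1,3)[of m] G(2) by blast
qed

text \<open>Colour \<open>2 * t + 2\<close> stands for the positive and \<open>2 * t + 3\<close> for the negative direction of
  coordinate \<open>t\<close>.\<close>
definition axis_of :: "nat \<Rightarrow> nat" where "axis_of c = c div 2 - 1"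

definition opposite :: "nat \<Rightarrow> nat" where "opposite c = (if even c then c + 1 else c - 1)"

definition colours :: "nat \<Rightarrow> nat set" where "colours n = {2..<2 * n + 2}"

lemma axis_of_simps [simp]: "axis_of (2 * t + 2) = t" "axis_of (2 * t + 3) = t" "axis_of (Suc (Suc (2 * t))) = t"
  by (auto simp: axis_of_def)

lemma opposite_simps [simp]: "opposite (2 * t + 2) = 2 * t + 3" "opposite (2 * t + 3) = 2 * t + 2"
  "opposite (Suc (Suc (2 * t))) = 2 * t + 3"
  by (auto simp: opposite_def)

lemma colours_cases:
  assumes "c \<in> colours n"
  obtains t where "t < n" "c = 2 * t + 2" | t where "t < n" "c = 2 * t + 3"
proof (cases "even c")
  case True
  then obtain m where "c = 2 * m" by blast
  with assms that(1)[of "m - 1"] show ?thesis by (cases m) (auto simp: colours_def)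
next
  case False
  then obtain m where "c = 2 * m + 1" by (rule oddE)
  with assms that(2)[of "m - 1"] show ?thesis by (cases m) (auto simp: colours_def)
qed

lemma in_colours: "t < n \<Longrightarrow> 2 * t + 2 \<in> colours n" "t < n \<Longrightarrow> 2 * t + 3 \<in> colours n"
  by (auto simp: colours_def)

lemma opposite_colour:
  assumes "c \<in> colours n"
  shows "opposite c \<in> colours n" "opposite (opposite c) = c"
proof -
  have "opposite c \<in> colours n \<and> opposite (opposite c) = c"
    using assms
  proof (cases rule: colours_cases)
    case (1 t)
    then show ?thesis using in_colours(2)[OF 1(1)] by (simp only: opposite_simps)
  next
    case (2 t)
    then show ?thesis using in_colours(1)[OF 2(1)] by (simp only: opposite_simps)
  qed
  then show "opposite c \<in> colours n" "opposite (opposite c) = c" by simp_all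
qed

lemma finite_colours: "finite (colours n)"
  by (simp add: colours_def)

text \<open>The flag \<open>b\<close> tells whether the chart has a boundary face, the face \<open>u (n - 1) = 0\<close> of \<open>slab\<close>.\<close>
locale cube_chart = computable_space X d \<alpha> q \<tau>1 \<tau>2 \<sigma> \<eta>
  for X :: "'a set" and d \<alpha> q \<tau>1 \<tau>2 \<sigma> \<eta> +
  fixes S B :: "'a set" and n :: nat and b :: bool and f :: "(nat \<Rightarrow> real) \<Rightarrow> 'a"
    and cube slab :: "(nat \<Rightarrow> real) set"
  defines "cube \<equiv> coord_box n (\<lambda>_. 0) (\<lambda>_. 1)"
    and "slab \<equiv> coord_box n (\<lambda>t. if b \<and> t = n - 1 then 0 else - 1) (\<lambda>_. 2)"
  assumes n: "1 \<le> n"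
    and S: "compactin mtopology S" "ce_set {j. S \<subseteq> runion j}"
    and B: "B \<subseteq> S" "ce_set {j. B \<subseteq> runion j}"
    and f: "continuous_map (top_of_set slab) mtopology f" "inj_on f slab" "f ` slab \<subseteq> S"
    and f_open: "openin (subtopology mtopology S) (f ` {u \<in> slab. \<forall>t<n. - 1 < u t \<and> u t < 2})"
    and B_sub: "B \<inter> f ` {u \<in> slab. \<forall>t<n. - 1 < u t \<and> u t < 2} \<subseteq> f ` {u \<in> slab. b \<and> u (n - 1) = 0}"
    and B_sup: "\<And>u. b \<Longrightarrow> u \<in> cube \<Longrightarrow> u (n - 1) = 0 \<Longrightarrow> f u \<in> B"
begin

abbreviation open_slab :: "(nat \<Rightarrow> real) set" where
  "open_slab \<equiv> {u \<in> slab. \<forall>t<n. - 1 < u t \<and> u t < 2}"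

text \<open>The boundary face \<open>u (n - 1) = 0\<close> has colour \<open>2 * n + 1\<close>; it gets no fixed balls if \<open>b\<close> holds.\<close>
definition face :: "nat \<Rightarrow> (nat \<Rightarrow> real) set" where
  "face c = {u \<in> cube. u (axis_of c) = (if even c then 1 else 0) \<and> \<not> (b \<and> c = 2 * n + 1)}"

text \<open>A region that contains the zone of the colour opposite to \<open>c\<close> around every
  core point, except for the boundary colour. It does not depend on that point, so guards kept apart
  from it can be fixed in advance.\<close>

definition far_side :: "nat \<Rightarrow> (nat \<Rightarrow> real) set" where
  "far_side c = {u \<in> slab. if even c then u (axis_of c) \<le> 3 / 4 else 1 / 4 \<le> u (axis_of c)}"

text \<open>The zones of all colours in \<open>colours n\<close> together cover the slab except for
  the points closer than \<open>e\<close> to \<open>p\<close> in every coordinate.\<close>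

definition zone :: "(nat \<Rightarrow> real) \<Rightarrow> real \<Rightarrow> nat \<Rightarrow> (nat \<Rightarrow> real) set" where
  "zone p e c = {u \<in> slab. if even c then p (axis_of c) + e \<le> u (axis_of c) else u (axis_of c) \<le> p (axis_of c) - e}"

text \<open>The margin of 1/4 separates core points from the guarded faces. There is none towards
  the boundary face, so that boundary points of the manifold can lie in a core.\<close>

definition core :: "(nat \<Rightarrow> real) set" where
  "core = {u \<in> slab. \<forall>t<n. (1 / 4 < u t \<or> b \<and> t = n - 1) \<and> u t < 3 / 4}"

lemma cube_subset: "cube \<subseteq> open_slab"
  by (force simp: cube_def slab_def coord_box_def)

lemma compact_image:
  assumes "closed Z" "Z \<subseteq> slab"
  shows "compactin mtopology (f ` Z)"
proof (rule image_compactin[OF _ f(1)])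
  have "compact Z"
    using compact_Int_closed[OF compact_coord_box assms(1)] assms(2)
    by (metis inf.absorb_iff2 slab_def)
  then show "compactin (top_of_set slab) Z" using assms(2) by (simp add: compactin_subtopology)
qed

lemma closed_coord_box: "closed (coord_box m x y)"
  by (rule compact_imp_closed[OF compact_coord_box])

lemma continuous_on_coord: "continuous_on UNIV (\<lambda>u. u t :: real)" for t :: nat
  by (rule continuous_on_product_then_coordinatewise[OF continuous_on_id])

lemma closed_coord:
  fixes t :: nat
  shows "closed {u. u t \<le> (a::real)}" "closed {u. (a::real) \<le> u t}" "closed {u. u t = (a::real)}"
  by (intro closed_Collect_le closed_Collect_eq continuous_on_coord continuous_on_const)+

lemma closed_if: "closed Y \<Longrightarrow> closed Z \<Longrightarrow> closed (if P then Y else Z)"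
  by simp

lemma compact_faces:
  "compactin mtopology (f ` face c)" "compactin mtopology (f ` far_side c)"
  "compactin mtopology (f ` zone p e c)" "compactin mtopology (f ` {u \<in> slab. b \<and> u (n - 1) = 0})"
  "compactin mtopology (f ` cube)"
proof -
  have "closed (face c)"
  proof -
    have "face c = (if b \<and> c = 2 * n + 1 then {} else cube \<inter> {u. u (axis_of c) = (if even c then 1 else 0)})"
      by (auto simp: face_def)
    then show ?thesis
      unfolding cube_def by (simp only:) (intro closed_if closed_empty closed_Int closed_coord_box closed_coord)
  qed
  moreover have "closed (far_side c)"
  proof -
    have "far_side c = slab \<inter> (if even c then {u. u (axis_of c) \<le> 3 / 4} else {u. 1 / 4 \<le> u (axis_of c)})"
      by (auto simp: far_side_def)
    then show ?thesis
      unfolding slab_def by (simp only:) (intro closed_if closed_empty closed_Int closed_coord_box closed_coord)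
  qed
  moreover have "closed (zone p e c)"
  proof -
    have "zone p e c = slab \<inter>
        (if even c then {u. p (axis_of c) + e \<le> u (axis_of c)} else {u. u (axis_of c) \<le> p (axis_of c) - e})"
      by (auto simp: zone_def)
    then show ?thesis
      unfolding slab_def by (simp only:) (intro closed_if closed_empty closed_Int closed_coord_box closed_coord)
  qed
  moreover have "closed {u \<in> slab. b \<and> u (n - 1) = 0}"
  proof -
    have "{u \<in> slab. b \<and> u (n - 1) = 0} = (if b then slab \<inter> {u. u (n - 1) = 0} else {})" by auto
    then show ?thesis
      unfolding slab_def by (simp only:) (intro closed_if closed_empty closed_Int closed_coord_box closed_coord)
  qed
  moreover have "closed cube" by (simp add: cube_def closed_coord_box)
  moreover have "face c \<subseteq> slab" "far_side c \<subseteq> slab" "zone p e c \<subseteq> slab"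
    "{u \<in> slab. b \<and> u (n - 1) = 0} \<subseteq> slab" "cube \<subseteq> slab"
    using cube_subset by (auto simp only: face_def far_side_def zone_def)
  ultimately show "compactin mtopology (f ` face c)" "compactin mtopology (f ` far_side c)"
    "compactin mtopology (f ` zone p e c)" "compactin mtopology (f ` {u \<in> slab. b \<and> u (n - 1) = 0})"
    "compactin mtopology (f ` cube)"
    by (simp_all only: compact_image)
qed

lemma disjoint_images: "Y \<subseteq> slab \<Longrightarrow> Z \<subseteq> slab \<Longrightarrow> Y \<inter> Z = {} \<Longrightarrow> f ` Y \<inter> f ` Z = {}"
  using inj_on_image_Int[OF f(2), of Y Z] by simp

definition outer_balls :: "nat set \<Rightarrow> bool" where
  "outer_balls F \<longleftrightarrow> finite F \<and> S - f ` open_slab \<subseteq> (\<Union>a\<in>F. rball a) \<and>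
     (\<forall>a\<in>F. rball a \<inter> f ` cube = {})"

text \<open>A pair of \<open>W\<close> is a guard with the colour of its face. The threshold
  \<open>r0\<close> turns formal disjointness from the guards into a mere condition of size and
  position for balls chosen later.\<close>

definition face_balls :: "(nat \<times> nat) set \<Rightarrow> real \<Rightarrow> bool" where
  "face_balls W r0 \<longleftrightarrow> finite W \<and> 0 < r0 \<and>
     (\<forall>c\<in>colours n. \<forall>u\<in>face c. \<exists>a. (a, c) \<in> W \<and> f u \<in> rball a) \<and>
     (\<forall>(a, c)\<in>W. c \<in> colours n \<and> \<not> (b \<and> c = 2 * n + 1) \<and>
       (\<forall>e. radius e < r0 \<longrightarrow> rball e \<inter> f ` far_side c \<noteq> {} \<longrightarrow> apart e a))"

lemma exists_outer_balls: "\<exists>F. outer_balls F"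
proof -
  let ?K = "S - f ` open_slab"
  have "closedin (subtopology mtopology S) ?K"
    using f_open openin_closedin_eq[of "subtopology mtopology S" "f ` open_slab"] S(1)
      compactin_subset_topspace[OF S(1)] by (simp add: inf.absorb2)
  then have "compactin (subtopology mtopology S) ?K"
    by (rule closedin_compact_space[OF compact_space_subtopology[OF S(1)]])
  then have K: "compactin mtopology ?K" by (simp add: compactin_subtopology)
  have disj: "?K \<inter> f ` cube = {}" using cube_subset by blast
  have "\<exists>r. (\<forall>x\<in>?K. \<forall>y\<in>f ` cube. 4 * r \<le> d x y) \<and> (0::real) < r"
    by (rule eventually_happens'[OF trivial_limit_at_right_real eventually_conj[OF
        compactin_disjoint_separated[OF K compact_faces(5) disj] eventually_at_right_less]])
  then obtain r where r: "\<And>x y. x \<in> ?K \<Longrightarrow> y \<in> f ` cube \<Longrightarrow> 4 * r \<le> d x y" "0 < r"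
    by blast
  from small_rball_cover[OF K r(2)] obtain F where F: "finite F" "?K \<subseteq> (\<Union>a\<in>F. rball a)"
    and F': "\<forall>a\<in>F. radius a < r \<and> rball a \<inter> ?K \<noteq> {}"
    by (elim exE conjE)
  have avoid: "rball a \<inter> f ` cube = {}" if a: "a \<in> F" for a
  proof (rule ccontr)
    assume "rball a \<inter> f ` cube \<noteq> {}"
    then obtain y where y: "y \<in> rball a" "y \<in> f ` cube" by blast
    obtain x where x: "x \<in> rball a" "x \<in> ?K" using F' a by blast
    have ra: "radius a < r" using F' a by blast
    have "d x y \<le> d x (center a) + d (center a) y"
      using x y by (intro triangle) (auto simp: in_rball center_in_space)
    \<comment> \<open>Through a common ball the distance would be below \<open>2 * r\<close>,
      against the separation \<open>4 * r\<close>.\<close>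
    then show False
      using r(1)[OF x(2) y(2)] r(2) ra x y commute[of x "center a"] by (simp add: in_rball)
  qed
  show ?thesis
    unfolding outer_balls_def by (intro exI[of _ F] conjI ballI F avoid)
qed

text \<open>A face and its far side differ by at least 1/4 in one coordinate, so injectivity of
  \<open>f\<close> makes their images disjoint compact sets. One \<open>r\<close> serves all
  colours, both as bound for the guards and as \<open>r0\<close>.\<close>

lemma exists_face_balls: "\<exists>W r0. face_balls W r0"
proof -
  have sep: "\<forall>\<^sub>F r in at_right 0. \<forall>c\<in>colours n. \<forall>x\<in>f ` far_side c. \<forall>y\<in>f ` face c. 4 * r \<le> d x y"
  proof (rule eventually_ball_finite[OF finite_colours], rule ballI,
      rule compactin_disjoint_separated[OF compact_faces(2,1)], rule disjoint_images)
    fix c assume "c \<in> colours n"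
    show "far_side c \<inter> face c = {}" by (auto simp: far_side_def face_def)
  qed (use cube_subset in \<open>auto simp: far_side_def face_def\<close>)
  have "\<exists>r. (\<forall>c\<in>colours n. \<forall>x\<in>f ` far_side c. \<forall>y\<in>f ` face c. 4 * r \<le> d x y) \<and> (0::real) < r"
    by (rule eventually_happens'[OF trivial_limit_at_right_real eventually_conj[OF sep eventually_at_right_less]])
  then obtain r where r: "\<And>c x y. c \<in> colours n \<Longrightarrow> x \<in> f ` far_side c \<Longrightarrow> y \<in> f ` face c \<Longrightarrow> 4 * r \<le> d x y"
    "0 < r" by blast
  have "\<forall>c. \<exists>A. finite A \<and> f ` face c \<subseteq> (\<Union>a\<in>A. rball a) \<and> (\<forall>a\<in>A. radius a < r \<and> rball a \<inter> f ` face c \<noteq> {})"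
    by (intro allI small_rball_cover compact_faces r(2))
  from choice[OF this] obtain A where A0: "\<forall>c. finite (A c) \<and> f ` face c \<subseteq> (\<Union>a\<in>A c. rball a) \<and>
      (\<forall>a\<in>A c. radius a < r \<and> rball a \<inter> f ` face c \<noteq> {})" by (elim exE)
  have A: "\<And>c. finite (A c)" "\<And>c. f ` face c \<subseteq> (\<Union>a\<in>A c. rball a)"
    "\<And>a c. a \<in> A c \<Longrightarrow> radius a < r" "\<And>a c. a \<in> A c \<Longrightarrow> rball a \<inter> f ` face c \<noteq> {}"
    using spec[OF A0] by simp_all
  define W where "W = (\<Union>c\<in>colours n. A c \<times> {c})"
  have W: "(a, c) \<in> W \<longleftrightarrow> c \<in> colours n \<and> a \<in> A c" for a c by (auto simp: W_def)
  have "face_balls W r"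
    unfolding face_balls_def
  proof (intro conjI ballI, goal_cases)
    case 1
    show ?case using A(1) finite_colours by (auto simp: W_def)
  next
    case (3 c u)
    then show ?case using A(2)[of c] by (auto simp: W)
  next
    case (4 w)
    obtain a c where w: "w = (a, c)" by fastforce
    have c: "c \<in> colours n" "a \<in> A c" using 4 W w by simp_all
    have "\<not> (b \<and> c = 2 * n + 1)" using A(4)[OF c(2)] by (auto simp: face_def)
    moreover have "apart e a" if "radius e < r" "rball e \<inter> f ` far_side c \<noteq> {}" for e
      using r(1)[OF c(1)] A(3,4)[OF c(2)] that
      by (intro apart_near[of "f ` far_side c" "f ` face c" r])
    ultimately show ?case using c(1) by (simp add: w)
  qed (rule r)
  then show ?thesis by blast
qed

section \<open>Soundness and completeness of certificates for a fixed choice of outer balls and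
  guards\<close>

context
  fixes F W r0
  assumes outer: "outer_balls F" and faces: "face_balls W r0"
begin

lemma F: "finite F" "S - f ` open_slab \<subseteq> (\<Union>a\<in>F. rball a)" "a \<in> F \<Longrightarrow> rball a \<inter> f ` cube = {}"
  using outer by (simp_all add: outer_balls_def)

lemma W:
  "finite W" "0 < r0"
  "c \<in> colours n \<Longrightarrow> u \<in> face c \<Longrightarrow> \<exists>a. (a, c) \<in> W \<and> f u \<in> rball a"
  "(a, c) \<in> W \<Longrightarrow> c \<in> colours n \<and> \<not> (b \<and> c = 2 * n + 1)"
  "(a, c) \<in> W \<Longrightarrow> radius e < r0 \<Longrightarrow> rball e \<inter> f ` far_side c \<noteq> {} \<Longrightarrow> apart e a"
proof -
  note W' = faces[unfolded face_balls_def]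
  show "finite W" "0 < r0" using W' by simp_all
  show "\<exists>a. (a, c) \<in> W \<and> f u \<in> rball a" if "c \<in> colours n" "u \<in> face c"
    using W' that by blast
  have W: "\<forall>(a, c)\<in>W. c \<in> colours n \<and> \<not> (b \<and> c = 2 * n + 1) \<and>
       (\<forall>e. radius e < r0 \<longrightarrow> rball e \<inter> f ` far_side c \<noteq> {} \<longrightarrow> apart e a)"
    using W' by (elim conjE)
  show "c \<in> colours n \<and> \<not> (b \<and> c = 2 * n + 1)" if "(a, c) \<in> W"
    using bspec[OF W that] by simp
  show "apart e a" if "(a, c) \<in> W" "radius e < r0" "rball e \<inter> f ` far_side c \<noteq> {}"
    using bspec[OF W that(1)] that(2,3) by simp
qed

text \<open>The last argument \<open>2 * n\<close> equals \<open>2 * (n - 1) + 2\<close>, the colour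
  of the direction that points away from the boundary face. Balls of this colour are the ones that
  the cover of \<open>B\<close> must keep off that face.\<close>

definition certificate :: "nat \<Rightarrow> nat \<Rightarrow> nat \<Rightarrow> nat \<Rightarrow> bool" where
  "certificate = coloured_cover F W (colours n) ((\<lambda>c. (c, opposite c)) ` colours n) (2 * n)"

lemma opposite_pair: "(x, y) \<in> (\<lambda>c. (c, opposite c)) ` colours n \<longleftrightarrow> x \<in> colours n \<and> y = opposite x"
  by auto

lemma certificateD:
  assumes "certificate i j c j'" "k \<le> \<eta> j"
  shows "\<sigma> c k = 0 \<and> \<sigma> j k \<in> F \<or> \<sigma> c k = 1 \<and> \<sigma> j k = i \<or> \<sigma> c k \<in> colours n"
    and "l \<le> \<eta> j \<Longrightarrow> \<sigma> c k \<in> colours n \<Longrightarrow> \<sigma> c l = opposite (\<sigma> c k) \<Longrightarrow> apart (\<sigma> j k) (\<sigma> j l)"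
    and "(a, opposite (\<sigma> c k)) \<in> W \<Longrightarrow> \<sigma> c k \<in> colours n \<Longrightarrow> apart (\<sigma> j k) a"
    and "l \<le> \<eta> j' \<Longrightarrow> \<sigma> c k = 2 * n \<Longrightarrow> \<sigma> j' l \<in> F \<or> \<sigma> j' l = i \<or> apart (\<sigma> j k) (\<sigma> j' l)"
proof -
  have "(\<sigma> c k = 0 \<and> \<sigma> j k \<in> F \<or> \<sigma> c k = 1 \<and> \<sigma> j k = i \<or> \<sigma> c k \<in> colours n) \<and>
     (\<forall>l\<le>\<eta> j. \<not> (\<sigma> c k \<in> colours n \<and> \<sigma> c l = opposite (\<sigma> c k)) \<or> apart (\<sigma> j k) (\<sigma> j l)) \<and>
     (\<forall>w\<in>W. \<not> (\<sigma> c k \<in> colours n \<and> snd w = opposite (\<sigma> c k)) \<or> apart (\<sigma> j k) (fst w)) \<and>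
     (\<sigma> c k \<noteq> 2 * n \<or> (\<forall>l\<le>\<eta> j'. \<sigma> j' l \<in> F \<or> \<sigma> j' l = i \<or> apart (\<sigma> j k) (\<sigma> j' l)))"
    using assms unfolding certificate_def coloured_cover_def opposite_pair by blast
  then show "\<sigma> c k = 0 \<and> \<sigma> j k \<in> F \<or> \<sigma> c k = 1 \<and> \<sigma> j k = i \<or> \<sigma> c k \<in> colours n"
    and "l \<le> \<eta> j \<Longrightarrow> \<sigma> c k \<in> colours n \<Longrightarrow> \<sigma> c l = opposite (\<sigma> c k) \<Longrightarrow> apart (\<sigma> j k) (\<sigma> j l)"
    and "(a, opposite (\<sigma> c k)) \<in> W \<Longrightarrow> \<sigma> c k \<in> colours n \<Longrightarrow> apart (\<sigma> j k) a"
    and "l \<le> \<eta> j' \<Longrightarrow> \<sigma> c k = 2 * n \<Longrightarrow> \<sigma> j' l \<in> F \<or> \<sigma> j' l = i \<or> apart (\<sigma> j k) (\<sigma> j' l)"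
    by fastforce+
qed

lemma certificate_sound:
  assumes cert: "certificate i j c j'" and j: "S \<subseteq> runion j" and j': "B \<subseteq> runion j'"
  shows "rball i \<inter> S \<noteq> {}"
proof
  assume empty: "rball i \<inter> S = {}"
  define G where "G col = {u \<in> cube. \<exists>k\<le>\<eta> j. \<sigma> c k = col \<and> f u \<in> rball (\<sigma> j k)}" for col
  have G_open: "openin (top_of_set cube) (G col)" for col
  proof -
    have "continuous_map (top_of_set cube) mtopology f"
      using continuous_map_from_subtopology_mono[OF f(1)] cube_subset by blast
    moreover have "openin mtopology (\<Union>k\<in>{k. k \<le> \<eta> j \<and> \<sigma> c k = col}. rball (\<sigma> j k))"
      using openin_rball by blast
    ultimately have "openin (top_of_set cube)
      {u \<in> topspace (top_of_set cube). f u \<in> (\<Union>k\<in>{k. k \<le> \<eta> j \<and> \<sigma> c k = col}. rball (\<sigma> j k))}"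
      by (rule openin_continuous_map_preimage)
    moreover have "{u \<in> topspace (top_of_set cube). f u \<in> (\<Union>k\<in>{k. k \<le> \<eta> j \<and> \<sigma> c k = col}. rball (\<sigma> j k))} = G col"
      by (auto simp: G_def)
    ultimately show ?thesis by simp
  qed
  have in_S: "f u \<in> S" if "u \<in> cube" for u using f(3) cube_subset that by blast
  have disj: "G col \<inter> G (opposite col) = {}" if "col \<in> colours n" for col
    using certificateD(2)[OF cert] that apart_disjoint unfolding G_def by blast
  have face: "u \<notin> face (opposite col)" if "u \<in> G col" "col \<in> colours n" for u col
  proof
    assume "u \<in> face (opposite col)"
    with W(3)[OF opposite_colour(1)[OF that(2)]] obtain a where "(a, opposite col) \<in> W" "f u \<in> rball a" by blast
    with that certificateD(3)[OF cert] apart_disjoint show False unfolding G_def by blast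
  qed
  show False
  proof (rule cube_covering[of n "\<lambda>t. G (2 * t + 2)" "\<lambda>t. G (2 * t + 3)"], fold cube_def)
    show "cube \<subseteq> (\<Union>t<n. G (2 * t + 2) \<union> G (2 * t + 3))"
    proof
      fix u assume u: "u \<in> cube"
      then obtain k where k: "k \<le> \<eta> j" "f u \<in> rball (\<sigma> j k)"
        using in_S j by (auto simp: runion_eq)
      \<comment> \<open>Colours 0 and 1 are impossible: balls of \<open>F\<close> miss the image of
        the cube, and the ball \<open>i\<close> misses \<open>S\<close> by assumption.\<close>
      have "\<sigma> c k \<in> colours n"
        using certificateD(1)[OF cert k(1)] k(2) u in_S[OF u] empty F(3) by blast
      then show "u \<in> (\<Union>t<n. G (2 * t + 2) \<union> G (2 * t + 3))"
        using u k by (cases rule: colours_cases) (force simp: G_def)+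
    qed
    show "G (2 * t + 2) \<inter> G (2 * t + 3) = {}" if "t < n" for t
      using disj[OF in_colours(1)[OF that]] by simp
    show "u t \<noteq> 1" if "t < n" "u \<in> G (2 * t + 3)" for t u
      using face[OF that(2) in_colours(2)[OF that(1)]] that unfolding G_def face_def by auto
    show "u t \<noteq> 0" if t: "t < n" and u: "u \<in> G (2 * t + 2)" for t u
    proof
      assume 0: "u t = 0"
      show False
      proof (cases "b \<and> t = n - 1")
        case False
        then show False
          using face[OF u in_colours(1)[OF t]] 0 u t unfolding G_def face_def by auto
      next
        case True
        \<comment> \<open>On the boundary face the guard is the ball of the cover \<open>j'\<close>
          that contains \<open>f u\<close>. It is neither in \<open>F\<close> nor equal to
          \<open>i\<close>, for the same reasons as above, so it must be apart from the ball
          \<open>k\<close>, although both contain \<open>f u\<close>.\<close>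
        obtain k where k: "u \<in> cube" "k \<le> \<eta> j" "\<sigma> c k = 2 * t + 2" "f u \<in> rball (\<sigma> j k)"
          using u by (auto simp: G_def)
        have "f u \<in> B" using B_sup k(1) True 0 by blast
        then obtain l where l: "l \<le> \<eta> j'" "f u \<in> rball (\<sigma> j' l)" using j' by (auto simp: runion_eq)
        have "\<sigma> c k = 2 * n" using k(3) True n by simp
        from certificateD(4)[OF cert k(2) l(1) this] show False
          using F(3) empty in_S[OF k(1)] k l(2) apart_disjoint by blast
      qed
    qed
  qed (rule G_open)+
qed

text \<open>Finitely many separations of compact sets hold for all small \<open>r\<close>. The
  second one holds because points of the slab have height at least 0 over the boundary face, so the
  zone of colour \<open>2 * n\<close> begins at height at least \<open>e\<close>.\<close>

lemma exists_small_radius: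
  assumes p: "p \<in> slab" and e: "0 < e"
  obtains r where "0 < r" "r < r0"
    "\<And>c x y. c \<in> colours n \<Longrightarrow> x \<in> f ` zone p e c \<Longrightarrow> y \<in> f ` zone p e (opposite c) \<Longrightarrow> 4 * r \<le> d x y"
    "\<And>x y. x \<in> f ` zone p e (2 * n) \<Longrightarrow> y \<in> f ` {u \<in> slab. b \<and> u (n - 1) = 0} \<Longrightarrow> 4 * r \<le> d x y"
proof -
  have 1: "\<forall>\<^sub>F r in at_right 0. \<forall>c\<in>colours n. \<forall>x\<in>f ` zone p e c. \<forall>y\<in>f ` zone p e (opposite c). 4 * r \<le> d x y"
  proof (rule eventually_ball_finite[OF finite_colours], rule ballI,
      rule compactin_disjoint_separated[OF compact_faces(3,3)], rule disjoint_images)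
    fix c assume "c \<in> colours n"
    then show "zone p e c \<inter> zone p e (opposite c) = {}"
      using e by (cases rule: colours_cases) (auto simp: zone_def)
  qed (auto simp: zone_def)
  have 2: "\<forall>\<^sub>F r in at_right 0. \<forall>x\<in>f ` zone p e (2 * n). \<forall>y\<in>f ` {u \<in> slab. b \<and> u (n - 1) = 0}. 4 * r \<le> d x y"
  proof (rule compactin_disjoint_separated[OF compact_faces(3,4)], rule disjoint_images)
    have "n - 1 < n" using n by simp
    then have "0 \<le> p (n - 1)" if b using p that by (auto simp: slab_def coord_box_def)
    moreover have "axis_of (2 * n) = n - 1" by (simp add: axis_of_def)
    ultimately show "zone p e (2 * n) \<inter> {u \<in> slab. b \<and> u (n - 1) = 0} = {}"
      using e by (auto simp: zone_def)
  qed (auto simp: zone_def)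
  have 3: "\<forall>\<^sub>F r in at_right 0. r < r0"
    using W(2) by (intro order_tendstoD(2)[OF tendsto_ident_at])
  have "\<exists>r. (\<forall>c\<in>colours n. \<forall>x\<in>f ` zone p e c. \<forall>y\<in>f ` zone p e (opposite c). 4 * r \<le> d x y) \<and>
    (\<forall>x\<in>f ` zone p e (2 * n). \<forall>y\<in>f ` {u \<in> slab. b \<and> u (n - 1) = 0}. 4 * r \<le> d x y) \<and> r < r0 \<and> 0 < r"
    by (rule eventually_happens'[OF trivial_limit_at_right_real eventually_conj[OF 1 eventually_conj[OF 2
        eventually_conj[OF 3 eventually_at_right_less]]]])
  then obtain r where r: "\<forall>c\<in>colours n. \<forall>x\<in>f ` zone p e c. \<forall>y\<in>f ` zone p e (opposite c). 4 * r \<le> d x y"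
    "\<forall>x\<in>f ` zone p e (2 * n). \<forall>y\<in>f ` {u \<in> slab. b \<and> u (n - 1) = 0}. 4 * r \<le> d x y" "r < r0" "0 < r"
    by (elim exE conjE)
  show ?thesis
  proof (rule that[of r])
    show "4 * r \<le> d x y"
      if "c \<in> colours n" "x \<in> f ` zone p e c" "y \<in> f ` zone p e (opposite c)" for c x y
      using r(1) that by blast
    show "4 * r \<le> d x y"
      if "x \<in> f ` zone p e (2 * n)" "y \<in> f ` {u \<in> slab. b \<and> u (n - 1) = 0}" for x y
      using r(2) that by blast
  qed (fact r)+
qed

text \<open>The signed balls come from small covers of the zones. Opposite zones are separated
  because their coordinates differ by at least \<open>2 * e\<close>, and the gap between them around
  \<open>p\<close> is filled by the ball \<open>i\<close>.\<close>

lemma certificate_complete: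
  assumes "p \<in> core" and i: "f p \<in> rball i"
  shows "\<exists>j c j'. S \<subseteq> runion j \<and> B \<subseteq> runion j' \<and> certificate i j c j'"
proof -
  have p: "p \<in> slab" "\<And>t. t < n \<Longrightarrow> 1 / 4 < p t \<or> b \<and> t = n - 1" "\<And>t. t < n \<Longrightarrow> p t < 3 / 4"
    using assms(1) by (simp_all add: core_def)
  have "openin (top_of_set slab) {u \<in> topspace (top_of_set slab). f u \<in> rball i}"
    using f(1) openin_rball by (rule openin_continuous_map_preimage)
  \<comment> \<open>Every point of the slab outside all zones of size \<open>e\<close> is thereby
    mapped into the ball \<open>i\<close>.\<close>
  then obtain e where e: "0 < e"
    "\<And>v. v \<in> slab \<Longrightarrow> (\<And>t. t < n \<Longrightarrow> \<bar>v t - p t\<bar> < e) \<Longrightarrow> v \<in> {u \<in> topspace (top_of_set slab). f u \<in> rball i}"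
    by (rule openin_coord_nhd[of slab _ p n]) (use p i in \<open>auto simp: slab_def coord_box_def\<close>)
  obtain r where r: "0 < r" "r < r0"
    "\<And>c x y. c \<in> colours n \<Longrightarrow> x \<in> f ` zone p e c \<Longrightarrow> y \<in> f ` zone p e (opposite c) \<Longrightarrow> 4 * r \<le> d x y"
    "\<And>x y. x \<in> f ` zone p e (2 * n) \<Longrightarrow> y \<in> f ` {u \<in> slab. b \<and> u (n - 1) = 0} \<Longrightarrow> 4 * r \<le> d x y"
    by (rule exists_small_radius[OF p(1) e(1)]) blast
  have "\<forall>c. \<exists>A. finite A \<and> f ` zone p e c \<subseteq> (\<Union>a\<in>A. rball a) \<and>
      (\<forall>a\<in>A. radius a < r \<and> rball a \<inter> f ` zone p e c \<noteq> {})"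
    by (intro allI small_rball_cover compact_faces r(1))
  from choice[OF this] obtain A where A0: "\<forall>c. finite (A c) \<and> f ` zone p e c \<subseteq> (\<Union>a\<in>A c. rball a) \<and>
      (\<forall>a\<in>A c. radius a < r \<and> rball a \<inter> f ` zone p e c \<noteq> {})" by (elim exE)
  have A: "\<And>c. finite (A c)" "\<And>c. f ` zone p e c \<subseteq> (\<Union>a\<in>A c. rball a)"
    "\<And>a c. a \<in> A c \<Longrightarrow> radius a < r" "\<And>a c. a \<in> A c \<Longrightarrow> rball a \<inter> f ` zone p e c \<noteq> {}"
    using spec[OF A0] by simp_all
  from small_rball_cover[OF compact_faces(4) r(1)]
  obtain D where D: "finite D" "f ` {u \<in> slab. b \<and> u (n - 1) = 0} \<subseteq> (\<Union>a\<in>D. rball a)"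
    and D': "\<forall>a\<in>D. radius a < r \<and> rball a \<inter> f ` {u \<in> slab. b \<and> u (n - 1) = 0} \<noteq> {}"
    by (elim exE conjE)
  \<comment> \<open>Balls are paired with their colours before coding, since one ball may occur with
    several colours; the two projections of a single list then give aligned codes \<open>j\<close>
    and \<open>c\<close>.\<close>
  define P where "P = F \<times> {0} \<union> {(i, 1)} \<union> (\<Union>c\<in>colours n. A c \<times> {c})"
  have "finite P" using F(1) A(1) finite_colours by (auto simp: P_def)
  from finite_list[OF this] obtain ps where ps: "set ps = P" by (elim exE)
  then have "ps \<noteq> []" by (auto simp: P_def)
  then have ne: "map fst ps \<noteq> []" "map snd ps \<noteq> []" by simp_all
  from exists_code[OF ne(1)] obtain j where j: "\<eta> j = length (map fst ps) - 1"
    "\<forall>k\<le>\<eta> j. \<sigma> j k = map fst ps ! k" "\<sigma> j ` {..\<eta> j} = set (map fst ps)" by (elim exE conjE)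
  from exists_code[OF ne(2)] obtain c where c: "\<eta> c = length (map snd ps) - 1"
    "\<forall>k\<le>\<eta> c. \<sigma> c k = map snd ps ! k" by (elim exE conjE)
  have jP: "fst ` P = \<sigma> j ` {..\<eta> j}" using j(3) ps by simp
  have jc: "(\<sigma> j k, \<sigma> c k) \<in> P" if "k \<le> \<eta> j" for k
  proof -
    have "k < length ps" using that j(1) \<open>ps \<noteq> []\<close> by (cases ps) auto
    then have "(\<sigma> j k, \<sigma> c k) = ps ! k" using j(1,2) c that by simp
    then show ?thesis using ps \<open>k < length ps\<close> nth_mem by metis
  qed
  \<comment> \<open>Colours of directions start at 2, so such an entry of \<open>P\<close> stems
    neither from \<open>F\<close> nor from \<open>i\<close>.\<close>
  have jcA: "\<sigma> j k \<in> A (\<sigma> c k)" if "k \<le> \<eta> j" "\<sigma> c k \<in> colours n" for k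
    using jc[OF that(1)] that(2) by (auto simp: P_def colours_def)
  \<comment> \<open>The cover of \<open>B\<close>: outside the open chart \<open>F\<close> covers
    it, and inside \<open>B_sub\<close> confines it to the boundary face, which \<open>D\<close>
    covers.\<close>
  have "finite (F \<union> {i} \<union> D)" using F(1) D(1) by simp
  from finite_list[OF this] obtain l where l: "set l = F \<union> {i} \<union> D" by (elim exE)
  then have "l \<noteq> []" by auto
  from exists_code[OF this] obtain j' where "\<sigma> j' ` {..\<eta> j'} = set l" by (elim exE conjE)
  with l have j': "\<sigma> j' ` {..\<eta> j'} = F \<union> {i} \<union> D" by simp
  show ?thesis
  proof (intro exI conjI)
    show "S \<subseteq> runion j"
    proof
      fix x assume x: "x \<in> S"
      have "\<exists>a\<in>fst ` P. x \<in> rball a"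
      proof (cases "x \<in> f ` open_slab")
        case False
        then obtain a where "a \<in> F" "x \<in> rball a" using F(2) x by blast
        then show ?thesis by (force simp: P_def)
      next
        case True
        then obtain v where v: "v \<in> slab" "x = f v" by blast
        show ?thesis
        proof (cases "\<forall>t<n. \<bar>v t - p t\<bar> < e")
          case True
          then have "x \<in> rball i" using e(2)[of v] v by auto
          then show ?thesis by (force simp: P_def)
        next
          case False
          then obtain t where t: "t < n" "e \<le> \<bar>v t - p t\<bar>" by (auto simp: not_less)
          have "v \<in> zone p e (2 * t + 2) \<or> v \<in> zone p e (2 * t + 3)"
            using t(2) v(1) by (auto simp: zone_def)
          then obtain col where col: "col \<in> colours n" "v \<in> zone p e col"
            using in_colours[OF t(1)] by blast
          then obtain a where "a \<in> A col" "x \<in> rball a" using A(2)[of col] v by blast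
          with col show ?thesis by (force simp: P_def)
        qed
      qed
      then show "x \<in> runion j" unfolding runion_eq jP by auto
    qed
    show "B \<subseteq> runion j'"
    proof
      fix x assume x: "x \<in> B"
      have "\<exists>a\<in>F \<union> {i} \<union> D. x \<in> rball a"
      proof (cases "x \<in> f ` open_slab")
        case False
        then show ?thesis using F(2) B(1) x by blast
      next
        case True
        then have "x \<in> f ` {u \<in> slab. b \<and> u (n - 1) = 0}" using B_sub x by blast
        then show ?thesis using D(2) by blast
      qed
      then show "x \<in> runion j'" unfolding runion_eq j'[symmetric] by auto
    qed
    show "certificate i j c j'"
      unfolding certificate_def coloured_cover_def opposite_pair
    proof (intro allI impI conjI)
      fix k assume k: "k \<le> \<eta> j"
      show "\<sigma> c k = 0 \<and> \<sigma> j k \<in> F \<or> \<sigma> c k = 1 \<and> \<sigma> j k = i \<or> \<sigma> c k \<in> colours n"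
        using jc[OF k] by (auto simp: P_def)
      have "apart (\<sigma> j k) (\<sigma> j l)"
        if l: "l \<le> \<eta> j" and col: "\<sigma> c k \<in> colours n" "\<sigma> c l = opposite (\<sigma> c k)" for l
      proof -
        have "\<sigma> j k \<in> A (\<sigma> c k)" "\<sigma> j l \<in> A (opposite (\<sigma> c k))"
          using jcA[OF k] jcA[OF l] col opposite_colour(1)[OF col(1)] by auto
        then show "apart (\<sigma> j k) (\<sigma> j l)"
          using A(3,4) r(3)[OF col(1)]
          by (intro apart_near[of "f ` zone p e (\<sigma> c k)" "f ` zone p e (opposite (\<sigma> c k))" r]) auto
      qed
      then show "\<not> (\<sigma> c k \<in> colours n \<and> \<sigma> c l = opposite (\<sigma> c k)) \<or> apart (\<sigma> j k) (\<sigma> j l)"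
        if "l \<le> \<eta> j" for l using that by blast
      have "apart (\<sigma> j k) (fst w)"
        if w: "w \<in> W" and col: "\<sigma> c k \<in> colours n" "snd w = opposite (\<sigma> c k)" for w
      proof -
        have w': "(fst w, opposite (\<sigma> c k)) \<in> W" using w col by (metis prod.collapse)
        have "zone p e (\<sigma> c k) \<subseteq> far_side (opposite (\<sigma> c k))"
          using col(1)
        proof (cases rule: colours_cases)
          case (1 t)
          \<comment> \<open>A core point has no margin towards the boundary face, but
            \<open>W\<close> holds no guards of that face, so the coordinate in question is another
            one.\<close>
          have "\<not> (b \<and> t = n - 1)" using W(4)[OF w'] 1 by auto
          then have "1 / 4 < p t" using p(2) 1 by blast
          then show ?thesis using 1 e(1) by (auto simp: zone_def far_side_def)
        next
          case (2 t)
          then show ?thesis using p(3)[of t] e(1) by (auto simp: zone_def far_side_def)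
        qed
        then have "rball (\<sigma> j k) \<inter> f ` far_side (opposite (\<sigma> c k)) \<noteq> {}"
          using A(4)[OF jcA[OF k col(1)]] by blast
        moreover have "radius (\<sigma> j k) < r0" using A(3)[OF jcA[OF k col(1)]] r(2) by simp
        ultimately show "apart (\<sigma> j k) (fst w)" using W(5)[OF w'] by blast
      qed
      then show "\<forall>w\<in>W. \<not> (\<sigma> c k \<in> colours n \<and> snd w = opposite (\<sigma> c k)) \<or> apart (\<sigma> j k) (fst w)"
        by blast
      have "apart (\<sigma> j k) (\<sigma> j' l)"
        if l: "l \<le> \<eta> j'" "\<sigma> j' l \<noteq> i" "\<sigma> j' l \<notin> F" and col: "\<sigma> c k = 2 * n" for l
      proof -
        have "\<sigma> j' l \<in> F \<union> {i} \<union> D" using l(1) j' by (metis atMost_iff imageI)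
        then have "\<sigma> j' l \<in> D" using l by blast
        moreover have "\<sigma> j k \<in> A (2 * n)"
          using jcA[OF k] col n by (auto simp: colours_def)
        ultimately show "apart (\<sigma> j k) (\<sigma> j' l)"
          using A(3,4) D' r(4)
          by (intro apart_near[of "f ` zone p e (2 * n)" "f ` {u \<in> slab. b \<and> u (n - 1) = 0}" r]) auto
      qed
      then show "\<sigma> c k \<noteq> 2 * n \<or> (\<forall>l\<le>\<eta> j'. \<sigma> j' l \<in> F \<or> \<sigma> j' l = i \<or> apart (\<sigma> j k) (\<sigma> j' l))"
        by blast
    qed
  qed
qed

lemma ce_set_certified:
  "ce_set {i. \<exists>j c j'. S \<subseteq> runion j \<and> B \<subseteq> runion j' \<and> certificate i j c j'}"
proof -
  have "finite (colours n)" "finite ((\<lambda>c. (c, opposite c)) ` colours n)"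
    by (simp_all add: finite_colours)
  from ce_set_coloured_cover[OF F(1) W(1) this S(2) B(2), of "2 * n"]
  show ?thesis unfolding certificate_def by (simp only: mem_Collect_eq)
qed

end

text \<open>A certificate for a ball proves only that it meets \<open>S\<close> somewhere, possibly
  outside the core; hence the set is located between two bounds instead of being determined.\<close>

theorem chart_ce_set:
  "\<exists>T. ce_set T \<and> T \<subseteq> {i. S \<inter> rball i \<noteq> {}} \<and> {i. f ` core \<inter> rball i \<noteq> {}} \<subseteq> T"
proof -
  obtain F W r0 where FW: "outer_balls F" "face_balls W r0"
    using exists_outer_balls exists_face_balls by blast
  let ?T = "{i. \<exists>j c j'. S \<subseteq> runion j \<and> B \<subseteq> runion j' \<and> certificate F W i j c j'}"
  have "ce_set ?T" by (rule ce_set_certified[OF FW])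
  moreover have "?T \<subseteq> {i. S \<inter> rball i \<noteq> {}}"
    using certificate_sound[OF FW] by blast
  moreover have "{i. f ` core \<inter> rball i \<noteq> {}} \<subseteq> ?T"
  proof
    fix i assume "i \<in> {i. f ` core \<inter> rball i \<noteq> {}}"
    then obtain p where "p \<in> core" "f p \<in> rball i" by blast
    then show "i \<in> ?T"
      using certificate_complete[OF FW] by simp
  qed
  ultimately show ?thesis by blast
qed

text \<open>Openness is known for the image of the open slab only. The complement of the core in the
  slab is compact, so its image is closed, and removing it leaves exactly the image of the core by
  injectivity.\<close>

lemma openin_core: "openin (subtopology mtopology S) (f ` core)"
proof -
  let ?Z = "slab - core"
  have Z: "?Z = (\<Union>t\<in>{..<n}. slab \<inter> ((if b \<and> t = n - 1 then {} else {u. u t \<le> 1 / 4}) \<union> {u. 3 / 4 \<le> u t}))"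
    by (auto simp: core_def not_less split: if_splits)
  have "closed ?Z"
    unfolding Z unfolding slab_def
    by (intro closed_UN ballI finite_lessThan closed_Int closed_coord_box closed_Un closed_if
        closed_empty closed_coord)
  then have "compactin mtopology (f ` ?Z)" by (intro compact_image) auto
  then have "closedin mtopology (f ` ?Z)" by (rule compactin_imp_closedin[OF Hausdorff_space_mtopology])
  then have "closedin (subtopology mtopology S) (S \<inter> f ` ?Z)" by (rule closedin_subtopology_Int_closed)
  then have "openin (subtopology mtopology S) (f ` open_slab - S \<inter> f ` ?Z)"
    by (rule openin_diff[OF f_open])
  moreover have "f ` open_slab - S \<inter> f ` ?Z = f ` core"
  proof -
    have "core \<subseteq> open_slab"
    proof
      fix u assume u: "u \<in> core"
      then have "u \<in> slab" by (simp add: core_def)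
      have "- 1 < u t \<and> u t < 2" if "t < n" for t
      proof -
        have "1 / 4 < u t \<or> b \<and> t = n - 1" "u t < 3 / 4" using u that by (auto simp: core_def)
        moreover have "0 \<le> u t" if "b \<and> t = n - 1"
          using \<open>u \<in> slab\<close> that \<open>t < n\<close> by (auto simp: slab_def coord_box_def)
        ultimately show ?thesis by linarith
      qed
      then show "u \<in> open_slab" using u by (simp add: core_def)
    qed
    then have "f ` core \<subseteq> f ` open_slab" by (rule image_mono)
    moreover have "f ` open_slab \<subseteq> f ` slab" by (rule image_mono) simp
    moreover have "f ` ?Z = f ` slab - f ` core"
      by (rule inj_on_image_set_diff[OF f(2)]) (simp_all add: core_def)
    ultimately show ?thesis using f(3) by (simp only:) blast
  qed
  ultimately show ?thesis by simp
qed

end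


section \<open>Charts of a manifold with boundary\<close>

definition half_coords :: "nat \<Rightarrow> (nat \<Rightarrow> real) set" where
  "half_coords n = {x. (\<forall>i\<ge>n. x i = 0) \<and> 0 \<le> x (n - 1)}"

lemma Euclidean_space_eq: "Euclidean_space n = top_of_set {x. \<forall>i\<ge>n. x i = 0}"
  by (simp add: Euclidean_space_def euclidean_product_topology)

lemma halfspace_eq: "halfspace n = top_of_set (half_coords n)"
  by (simp add: halfspace_def Euclidean_space_eq subtopology_subtopology half_coords_def Collect_conj_eq)

lemma open_coord_greater: "open {z :: nat \<Rightarrow> real. c < z t}" "open {z :: nat \<Rightarrow> real. z t < c}"
  by (intro open_Collect_less continuous_on_const
      continuous_on_product_then_coordinatewise[OF continuous_on_id])+

lemma openin_Euclidean_space_move_down: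
  assumes G: "openin (Euclidean_space n) G" and w: "w \<in> G" and n: "1 \<le> n"
  obtains v where "v \<in> G" "v (n - 1) < w (n - 1)"
proof -
  obtain e where e: "0 < e" "\<And>v. v \<in> {x. \<forall>i\<ge>n. x i = 0} \<Longrightarrow> (\<And>t. t < n \<Longrightarrow> \<bar>v t - w t\<bar> < e) \<Longrightarrow> v \<in> G"
    using G[unfolded Euclidean_space_eq] w by (rule openin_coord_nhd) auto
  have wE: "w \<in> {x. \<forall>i\<ge>n. x i = 0}"
    using openin_subset[OF G] w by (auto simp: Euclidean_space_eq)
  have "w(n - 1 := w (n - 1) - e / 2) \<in> G"
    by (rule e(2)) (use wE n e(1) in auto)
  then show ?thesis by (rule that) (use e(1) in simp)
qed

text \<open>Invariance of domain: a transition map would take an open subset of Euclidean space onto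
  an open set touching the boundary of the half space.\<close>
lemma positive_coord_not_boundary:
  assumes n: "1 \<le> n" and U: "openin T U" "y \<in> U" "U \<subseteq> N" and N: "N \<subseteq> topspace T"
    and V: "openin (halfspace n) V"
    and hk: "homeomorphic_maps (subtopology T N) (subtopology (halfspace n) V) h k"
    and pos: "0 < h y (n - 1)"
  shows "y \<notin> manifold_boundary T n"
proof
  assume "y \<in> manifold_boundary T n"
  then obtain N' V' f' where N': "is_nhd T N' y" and V': "openin (halfspace n) V'"
    and hom': "homeomorphic_map (subtopology T N') (subtopology (halfspace n) V') f'" and 0: "f' y (n - 1) = 0"
    unfolding manifold_boundary_def by blast
  obtain U' where U': "openin T U'" "y \<in> U'" "U' \<subseteq> N'" "N' \<subseteq> topspace T"
    using N' unfolding is_nhd_def by blast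
  have top: "topspace (subtopology T N) = N" "topspace (subtopology T N') = N'"
    using N U'(4) by auto
  have topV: "topspace (subtopology (halfspace n) V) = V"
    using openin_subset[OF V] by auto
  have h: "continuous_map (subtopology T N) (subtopology (halfspace n) V) h"
    and k: "continuous_map (subtopology (halfspace n) V) (subtopology T N) k"
    and kh: "\<And>x. x \<in> N \<Longrightarrow> k (h x) = x" and hk': "\<And>z. z \<in> V \<Longrightarrow> h (k z) = z"
    using hk unfolding homeomorphic_maps_def top topV by blast+
  define P where "P = {z \<in> V. k z \<in> U \<inter> U'}"
  have "openin T (U \<inter> U')" using U(1) U'(1) by (rule openin_Int)
  then have "openin (subtopology T N) (U \<inter> U')"
    using U(3) by (auto simp: openin_subtopology intro!: exI[of _ "U \<inter> U'"])
  then have "openin (subtopology (halfspace n) V) {z \<in> topspace (subtopology (halfspace n) V). k z \<in> U \<inter> U'}"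
    by (rule openin_continuous_map_preimage[OF k])
  then have "openin (subtopology (halfspace n) V) P" by (simp only: topV P_def)
  then have P: "openin (halfspace n) P" using V by (rule openin_trans_full)
  \<comment> \<open>Restricting to positive height turns a relatively open set of the half space
    into an open set of Euclidean space, as invariance of domain demands.\<close>
  define O' where "O' = P \<inter> {z. 0 < z (n - 1)}"
  have O': "openin (Euclidean_space n) O'"
  proof -
    obtain G where G: "open G" "P = half_coords n \<inter> G"
      using P unfolding halfspace_eq openin_open by blast
    have "O' = {x. \<forall>i\<ge>n. x i = 0} \<inter> (G \<inter> {z. 0 < z (n - 1)})"
      by (auto simp: O'_def G(2) half_coords_def)
    then show ?thesis
      unfolding Euclidean_space_eq openin_open using open_Int[OF G(1) open_coord_greater(1)] by blast
  qed
  have OV: "O' \<subseteq> V" by (auto simp: O'_def P_def)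
  have kO: "k ` O' \<subseteq> U'" by (auto simp: O'_def P_def)
  have half_E: "continuous_map (subtopology (halfspace n) W) (Euclidean_space n) id" for W
    unfolding halfspace_def by (intro continuous_map_from_subtopology continuous_map_id)
  have k': "continuous_map (subtopology (Euclidean_space n) O') (subtopology T N') k"
  proof -
    have "O' \<subseteq> half_coords n" using P openin_subset[OF P] by (auto simp: O'_def halfspace_eq)
    then have "{x. \<forall>i\<ge>n. x i = 0} \<inter> O' = O'" "half_coords n \<inter> V \<inter> O' = O'"
      using OV by (auto simp: half_coords_def)
    then have "subtopology (Euclidean_space n) O' = subtopology (subtopology (halfspace n) V) O'"
      by (simp only: Euclidean_space_eq halfspace_eq subtopology_subtopology)
    then have "continuous_map (subtopology (Euclidean_space n) O') (subtopology T N) k"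
      using continuous_map_from_subtopology[OF k, of O'] by simp
    then have "continuous_map (subtopology (Euclidean_space n) O') T k"
      by (simp add: continuous_map_in_subtopology)
    then show ?thesis
      using kO U'(3) by (auto simp: continuous_map_in_subtopology)
  qed
  have f': "continuous_map (subtopology T N') (subtopology (halfspace n) V') f'" "inj_on f' N'"
    using hom' homeomorphic_imp_continuous_map homeomorphic_imp_injective_map top(2) by metis+
  have "continuous_map (subtopology T N') (Euclidean_space n) f'"
    using continuous_map_compose[OF f'(1) half_E] by simp
  from continuous_map_compose[OF k' this]
  have "continuous_map (subtopology (Euclidean_space n) O') (Euclidean_space n) (f' \<circ> k)" .
  moreover have "inj_on (f' \<circ> k) O'"
  proof (rule comp_inj_on)
    show "inj_on k O'" using hk' OV by (intro inj_on_inverseI[of _ h]) auto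
    show "inj_on f' (k ` O')" using f'(2) kO U'(3) by (meson inj_on_subset order_trans)
  qed
  ultimately have "openin (Euclidean_space n) ((f' \<circ> k) ` O')"
    using O' by (intro invariance_of_domain_Euclidean_space)
  moreover have "f' y \<in> (f' \<circ> k) ` O'"
  proof -
    have yN: "y \<in> N" using U by blast
    have "h y \<in> V" using continuous_map_image_subset_topspace[OF h] yN unfolding top topV by blast
    then have "h y \<in> O'" using pos kh[OF yN] U(2) U'(2) by (simp add: O'_def P_def)
    then show ?thesis using kh[OF yN] by (metis comp_apply image_eqI)
  qed
  \<comment> \<open>The open image contains a point of height 0, hence also one of negative height;
    but it consists of values of \<open>f'\<close>, which lie in the half space.\<close>
  ultimately obtain v where "v \<in> (f' \<circ> k) ` O'" "v (n - 1) < f' y (n - 1)"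
    by (rule openin_Euclidean_space_move_down[OF _ _ n])
  moreover have "0 \<le> v (n - 1)" if "v \<in> (f' \<circ> k) ` O'" for v
  proof -
    have "f' ` N' \<subseteq> topspace (halfspace n)"
      using continuous_map_image_subset_topspace[OF f'(1)] unfolding top by auto
    then show ?thesis using that kO U'(3) by (auto simp: halfspace_eq half_coords_def)
  qed
  ultimately show False using 0 by fastforce
qed

section \<open>Rescaled charts around a point\<close>

context computable_space
begin

text \<open>The given chart around \<open>x\<close> is rescaled by an affine map so that the slab
  fits into its domain and \<open>x\<close> becomes the center of the unit cube, or of its boundary
  face if the chart puts \<open>x\<close> at height 0.\<close>

lemma exists_chart_ce_set:
  fixes S n
  defines "T \<equiv> subtopology mtopology S"
  defines "B \<equiv> manifold_boundary T n"
  assumes "S \<subseteq> X" and man: "manifold_with_boundary T n"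
    and S: "compactin mtopology S" "ce_set {j. S \<subseteq> runion j}" and B: "ce_set {j. B \<subseteq> runion j}"
    and x: "x \<in> S"
  shows "\<exists>A W. ce_set A \<and> openin T W \<and> x \<in> W \<and> A \<subseteq> {i. S \<inter> rball i \<noteq> {}} \<and>
    {i. W \<inter> rball i \<noteq> {}} \<subseteq> A"
proof -
  have topT: "topspace T = S" using \<open>S \<subseteq> X\<close> by (auto simp: T_def)
  have n: "1 \<le> n" using man unfolding manifold_with_boundary_def by blast
  obtain N V where N: "is_nhd T N x" and V: "openin (halfspace n) V"
    and hom: "subtopology T N homeomorphic_space subtopology (halfspace n) V"
    using man x unfolding manifold_with_boundary_def topT by blast
  obtain U where U: "openin T U" "x \<in> U" "U \<subseteq> N" "N \<subseteq> topspace T"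
    using N unfolding is_nhd_def by blast
  obtain h k where hk: "homeomorphic_maps (subtopology T N) (subtopology (halfspace n) V) h k"
    using hom unfolding homeomorphic_space_def by blast
  have topN: "topspace (subtopology T N) = N" using U(4) by auto
  have topV: "topspace (subtopology (halfspace n) V) = V"
    using openin_subset[OF V] by auto
  have h: "continuous_map (subtopology T N) (subtopology (halfspace n) V) h"
    and k: "continuous_map (subtopology (halfspace n) V) (subtopology T N) k"
    and kh: "\<And>y. y \<in> N \<Longrightarrow> k (h y) = y" and hk': "\<And>z. z \<in> V \<Longrightarrow> h (k z) = z"
    using hk unfolding homeomorphic_maps_def topN topV by blast+
  have hV: "h y \<in> V" if "y \<in> N" for y
    using continuous_map_image_subset_topspace[OF h] that unfolding topN topV by blast
  have Vhalf: "V \<subseteq> half_coords n" using openin_subset[OF V] by (simp add: halfspace_eq)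
  define P where "P = {z \<in> V. k z \<in> U}"
  have P: "openin (top_of_set (half_coords n)) P"
  proof -
    have "openin (subtopology T N) U"
      using U(1,3) by (auto simp: openin_subtopology intro!: exI[of _ U])
    then have "openin (subtopology (halfspace n) V) {z \<in> topspace (subtopology (halfspace n) V). k z \<in> U}"
      by (rule openin_continuous_map_preimage[OF k])
    then have "openin (subtopology (halfspace n) V) P" by (simp only: topV P_def)
    then show ?thesis using V unfolding halfspace_eq by (rule openin_trans_full)
  qed
  have xN: "x \<in> N" using U by blast
  have "h x \<in> P" using hV[OF xN] kh[OF xN] U(2) by (simp add: P_def)
  obtain e0 where e0: "0 < e0" "\<And>v. v \<in> half_coords n \<Longrightarrow> (\<And>t. t < n \<Longrightarrow> \<bar>v t - h x t\<bar> < e0) \<Longrightarrow> v \<in> P"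
    using P \<open>h x \<in> P\<close> by (rule openin_coord_nhd) (auto simp: half_coords_def)
  define b where "b \<longleftrightarrow> h x (n - 1) = 0"
  have hx: "h x \<in> half_coords n" using hV[OF xN] Vhalf by blast
  \<comment> \<open>The rescaled slab deviates from \<open>h x\<close> by at most
    \<open>2 * e\<close> in each coordinate, which is below \<open>e0\<close>. In an interior chart
    it reaches down by \<open>3 * e / 2\<close> only, which is less than the height of
    \<open>h x\<close>, so it stays off the boundary of the half space.\<close>
  define e where "e = (if b then e0 / 4 else min (e0 / 4) (h x (n - 1) / 4))"
  have e: "0 < e" "e \<le> e0 / 4" "\<not> b \<Longrightarrow> e \<le> h x (n - 1) / 4"
    using e0(1) hx by (auto simp: e_def b_def half_coords_def)
  \<comment> \<open>The offset makes the parameter value 1/2 correspond to \<open>h x\<close>; in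
    the boundary direction the value 0 does, with no offset.\<close>
  define base where "base t = (if b \<and> t = n - 1 then 0 else h x t - e / 2)" for t
  define aff where "aff u = (\<lambda>t. if t < n then base t + e * u t else 0)" for u
  define slab where "slab = coord_box n (\<lambda>t. if b \<and> t = n - 1 then 0 else - 1) (\<lambda>_. 2)"
  define f where "f u = k (aff u)" for u
  have slabD: "- 1 \<le> u t" "u t \<le> 2" "b \<Longrightarrow> t = n - 1 \<Longrightarrow> 0 \<le> u t" if "u \<in> slab" "t < n" for u t
    using that by (auto simp: slab_def coord_box_def split: if_splits)
  have aff_P: "aff u \<in> P" if u: "u \<in> slab" for u
  proof (rule e0(2))
    have "0 \<le> aff u (n - 1)"
    proof (cases b)
      case True
      then show ?thesis using slabD(3)[OF u, of "n - 1"] n e(1) by (simp add: aff_def base_def)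
    next
      case False
      have "e * (- 1) \<le> e * u (n - 1)"
        using slabD(1)[OF u, of "n - 1"] n e(1) by (intro mult_left_mono) auto
      then show ?thesis using False e(1,3) n by (simp add: aff_def base_def)
    qed
    then show "aff u \<in> half_coords n" by (simp add: half_coords_def aff_def)
    fix t assume t: "t < n"
    define w where "w = e * u t"
    have "- e \<le> w" "w \<le> 2 * e"
      using slabD(1,2)[OF u t] mult_left_mono[of "- 1" "u t" e] mult_left_mono[of "u t" 2 e] e(1)
      by (simp_all add: w_def)
    then show "\<bar>aff u t - h x t\<bar> < e0"
      using t e(1,2) e0(1) by (auto simp: aff_def base_def b_def abs_if w_def[symmetric])
  qed
  have h_f: "h (f u) = aff u" if "u \<in> slab" for u
    using hk' aff_P[OF that] by (simp add: f_def P_def)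
  have f_U: "f u \<in> U" if "u \<in> slab" for u
    using aff_P[OF that] by (simp add: f_def P_def)
  have aff_inj: "u = v" if "aff u = aff v" "u \<in> slab" "v \<in> slab" for u v
  proof
    fix t
    show "u t = v t"
    proof (cases "t < n")
      case True
      then show ?thesis using fun_cong[OF that(1), of t] e(1) by (simp add: aff_def)
    next
      case False
      then show ?thesis using that(2,3) by (simp add: slab_def coord_box_def)
    qed
  qed
  have aff_cont: "continuous_on slab aff"
  proof (rule continuous_on_coordinatewise_then_product)
    fix t
    show "continuous_on slab (\<lambda>u. aff u t)"
      unfolding aff_def
      by (cases "t < n") (auto intro!: continuous_intros
          continuous_on_product_then_coordinatewise[OF continuous_on_id])
  qed
  interpret cube_chart X d \<alpha> q \<tau>1 \<tau>2 \<sigma> \<eta> S B n b f "coord_box n (\<lambda>_. 0) (\<lambda>_. 1)"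
    "coord_box n (\<lambda>t. if b \<and> t = n - 1 then 0 else - 1) (\<lambda>_. 2)"
  proof (unfold_locales, fold slab_def)
    show "1 \<le> n" by (rule n)
    show "compactin mtopology S" "ce_set {j. S \<subseteq> runion j}" "ce_set {j. B \<subseteq> runion j}" by fact+
    show "B \<subseteq> S" by (auto simp: B_def manifold_boundary_def topT)
    show "continuous_map (top_of_set slab) mtopology f"
    proof -
      have "continuous_map (top_of_set slab) (subtopology (halfspace n) V) aff"
        unfolding halfspace_eq subtopology_subtopology
        using aff_cont aff_P Vhalf by (auto simp: continuous_map_in_subtopology P_def)
      from continuous_map_compose[OF this k] show ?thesis
        by (simp add: T_def continuous_map_in_subtopology f_def[abs_def] o_def)
    qed
    show "inj_on f slab"
      using h_f aff_inj by (intro inj_onI) metis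
    show "f ` slab \<subseteq> S" using f_U openin_subset[OF U(1)] topT by blast
    show "openin (subtopology mtopology S) (f ` {u \<in> slab. \<forall>t<n. - 1 < u t \<and> u t < 2})"
    proof -
      let ?G = "\<Inter>t\<in>{..<n}. {z. base t - e < z t} \<inter> {z. z t < base t + 2 * e}"
      have "open ?G" by (intro open_INT finite_lessThan ballI open_Int open_coord_greater)
      then have "openin (subtopology (halfspace n) V) (topspace (subtopology (halfspace n) V) \<inter> ?G)"
        unfolding halfspace_eq subtopology_subtopology by (simp add: openin_open_Int)
      then have "openin (subtopology T N)
          {y \<in> topspace (subtopology T N). h y \<in> topspace (subtopology (halfspace n) V) \<inter> ?G}"
        by (rule openin_continuous_map_preimage[OF h])
      then obtain Q where Q: "openin T Q" "{y \<in> N. h y \<in> V \<inter> ?G} = Q \<inter> N"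
        unfolding topN topV openin_subtopology by blast
      \<comment> \<open>\<open>N\<close> need not be open in \<open>T\<close>, so the preimage of
        the open box is known to be open only relative to \<open>N\<close>; intersecting with the
        open set \<open>U\<close> inside \<open>N\<close> repairs this.\<close>
      have "f ` {u \<in> slab. \<forall>t<n. - 1 < u t \<and> u t < 2} = U \<inter> Q"
      proof (intro equalityI subsetI)
        fix y assume "y \<in> f ` {u \<in> slab. \<forall>t<n. - 1 < u t \<and> u t < 2}"
        then obtain u where u: "u \<in> slab" "\<And>t. t < n \<Longrightarrow> - 1 < u t \<and> u t < 2" "y = f u" by blast
        have yU: "y \<in> U" using f_U u by simp
        have "h y \<in> ?G"
        proof (intro INT_I)
          fix t assume "t \<in> {..<n}"
          then have t: "t < n" by simp
          define w where "w = e * u t"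
          have "- e < w" "w < 2 * e"
            using u(2)[OF t] mult_strict_left_mono[of "- 1" "u t" e]
              mult_strict_left_mono[of "u t" 2 e] e(1) by (simp_all add: w_def)
          then show "h y \<in> {z. base t - e < z t} \<inter> {z. z t < base t + 2 * e}"
            using t by (simp add: u(3) h_f[OF u(1)] aff_def w_def[symmetric])
        qed
        then have "y \<in> {y \<in> N. h y \<in> V \<inter> ?G}" using yU U(3) hV by blast
        then show "y \<in> U \<inter> Q" using yU Q(2) by blast
      next
        fix y assume y: "y \<in> U \<inter> Q"
        then have "y \<in> {y \<in> N. h y \<in> V \<inter> ?G}" using Q(2) U(3) by blast
        then have yN: "y \<in> N" and G: "\<And>t. t < n \<Longrightarrow> base t - e < h y t \<and> h y t < base t + 2 * e" by auto
        have hy: "h y \<in> half_coords n" using hV[OF yN] Vhalf by blast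
        define u where "u t = (if t < n then (h y t - base t) / e else 0)" for t
        have aff_u: "aff u = h y"
          using hy e(1) by (auto simp: fun_eq_iff aff_def u_def half_coords_def)
        have u: "- 1 < u t \<and> u t < 2" if "t < n" for t
          using G[OF that] that e(1) by (auto simp: u_def field_simps)
        have "0 \<le> u (n - 1)" if b
          using that hy e(1) by (auto simp: u_def base_def half_coords_def)
        then have "u \<in> slab"
          using u by (auto simp: slab_def coord_box_def less_imp_le) (simp_all add: u_def)
        moreover have "y = f u" by (simp add: f_def aff_u kh[OF yN])
        ultimately show "y \<in> f ` {u \<in> slab. \<forall>t<n. - 1 < u t \<and> u t < 2}" using u by blast
      qed
      then show ?thesis using openin_Int[OF U(1) Q(1)] by (simp add: T_def)
    qed
    show "B \<inter> f ` {u \<in> slab. \<forall>t<n. - 1 < u t \<and> u t < 2} \<subseteq> f ` {u \<in> slab. b \<and> u (n - 1) = 0}"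
    proof
      fix y assume "y \<in> B \<inter> f ` {u \<in> slab. \<forall>t<n. - 1 < u t \<and> u t < 2}"
      then obtain u where yB: "y \<in> B" and u: "u \<in> slab" "y = f u" "- 1 < u (n - 1)" using n by auto
      have "b \<and> u (n - 1) = 0"
      proof (rule ccontr)
        assume nb: "\<not> (b \<and> u (n - 1) = 0)"
        \<comment> \<open>Off the face \<open>u (n - 1) = 0\<close> of a boundary chart, and
          everywhere in an interior chart, \<open>h y\<close> has positive height. Then no other
          chart can put \<open>y\<close> on the boundary.\<close>
        have "0 < aff u (n - 1)"
        proof (cases b)
          case True
          then have "0 < u (n - 1)" using nb slabD(3)[OF u(1), of "n - 1"] n by force
          then show ?thesis using True n e(1) by (simp add: aff_def base_def)
        next
          case False
          have "e * (- 1) < e * u (n - 1)"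
            using u(3) e(1) by (intro mult_strict_left_mono) auto
          then show ?thesis using False e(1,3) n by (simp add: aff_def base_def)
        qed
        then have "0 < h y (n - 1)" by (simp add: u(2) h_f[OF u(1)])
        then have "y \<notin> B"
          unfolding B_def using f_U[OF u(1)] u(2)
          by (intro positive_coord_not_boundary[OF n U(1) _ U(3,4) V hk]) auto
        then show False using yB by blast
      qed
      then show "y \<in> f ` {u \<in> slab. b \<and> u (n - 1) = 0}" using u by blast
    qed
    show "f u \<in> B" if b: b and u: "u \<in> coord_box n (\<lambda>_. 0) (\<lambda>_. 1)" and u0: "u (n - 1) = 0" for u
    proof -
      have us: "u \<in> slab" using u by (force simp: slab_def coord_box_def)
      have "h (f u) (n - 1) = 0" using b u0 by (simp add: h_f[OF us] aff_def base_def)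
      moreover have "is_nhd T N (f u)" using U f_U[OF us] unfolding is_nhd_def by blast
      moreover have "homeomorphic_map (subtopology T N) (subtopology (halfspace n) V) h"
        using hk homeomorphic_map_maps by blast
      moreover have "f u \<in> topspace T" using f_U[OF us] openin_subset[OF U(1)] by blast
      ultimately show ?thesis unfolding B_def manifold_boundary_def using V by blast
    qed
  qed
  have "x \<in> f ` core"
  proof -
    \<comment> \<open>The parameter of \<open>x\<close>: coordinate 0 in the boundary direction of a
      boundary chart and 1/2 elsewhere, hence a core point.\<close>
    define u where "u t = (if t < n \<and> \<not> (b \<and> t = n - 1) then 1 / 2 else 0 :: real)" for t
    have "u \<in> core" by (auto simp: core_def coord_box_def u_def)
    moreover have "aff u = h x"
      using hx by (auto simp: fun_eq_iff aff_def base_def u_def half_coords_def b_def)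
    then have "f u = x" by (simp add: f_def kh[OF xN])
    ultimately show ?thesis by blast
  qed
  moreover have "openin T (f ` core)" unfolding T_def by (rule openin_core)
  ultimately show ?thesis using chart_ce_set by blast
qed

end

section \<open>From single charts to the whole manifold by compactness\<close>

theorem theorem6p1:
  fixes X :: "'a set" and d :: "'a \<Rightarrow> 'a \<Rightarrow> real" and \<alpha> :: "nat \<Rightarrow> 'a"
    and q :: "nat \<Rightarrow> rat" and \<tau>1 \<tau>2 :: "nat \<Rightarrow> nat"
    and \<sigma> :: "nat \<Rightarrow> nat \<Rightarrow> nat" and \<eta> :: "nat \<Rightarrow> nat"
    and S :: "'a set" and n :: nat
  assumes "computable_metric_space X d \<alpha>"
    and "standard_enums q \<tau>1 \<tau>2 \<sigma> \<eta>"
    and "S \<subseteq> X"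
    and "manifold_with_boundary (subtopology (Metric_space.mtopology X d) S) n"
    and "semicomputable_compact X d \<alpha> q \<tau>1 \<tau>2 \<sigma> \<eta> S"
    and "semicomputable_compact X d \<alpha> q \<tau>1 \<tau>2 \<sigma> \<eta>
           (manifold_boundary (subtopology (Metric_space.mtopology X d) S) n)"
  shows "computable_compact X d \<alpha> q \<tau>1 \<tau>2 \<sigma> \<eta> S"
proof -
  have "Metric_space X d" using assms(1) unfolding computable_metric_space_def by blast
  then interpret computable_space X d \<alpha> q \<tau>1 \<tau>2 \<sigma> \<eta>
    using assms(1,2) by (intro computable_space.intro computable_space_axioms.intro)
  let ?T = "subtopology mtopology S"
  have S: "compactin mtopology S" "ce_set {j. S \<subseteq> runion j}"
    using assms(5) unfolding semicomputable_compact_def by blast+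
  have B: "ce_set {j. manifold_boundary ?T n \<subseteq> runion j}"
    using assms(6) unfolding semicomputable_compact_def by blast
  have "\<forall>x\<in>S. \<exists>A W. ce_set A \<and> openin ?T W \<and> x \<in> W \<and> A \<subseteq> {i. S \<inter> rball i \<noteq> {}} \<and>
    {i. W \<inter> rball i \<noteq> {}} \<subseteq> A"
    using exists_chart_ce_set[OF assms(3,4) S B] by blast
  from bchoice[OF this] obtain A where "\<forall>x\<in>S. \<exists>W. ce_set (A x) \<and> openin ?T W \<and> x \<in> W \<and>
    A x \<subseteq> {i. S \<inter> rball i \<noteq> {}} \<and> {i. W \<inter> rball i \<noteq> {}} \<subseteq> A x" by (elim exE)
  from bchoice[OF this] obtain W where W: "\<forall>x\<in>S. ce_set (A x) \<and> openin ?T (W x) \<and> x \<in> W x \<and>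
    A x \<subseteq> {i. S \<inter> rball i \<noteq> {}} \<and> {i. W x \<inter> rball i \<noteq> {}} \<subseteq> A x" by (elim exE)
  have cS: "compactin ?T S" using S(1) by (simp add: compactin_subtopology)
  have op: "openin ?T Q" if "Q \<in> W ` S" for Q using W that by blast
  have cov: "S \<subseteq> \<Union>(W ` S)" using W by blast
  have "\<exists>\<F>. finite \<F> \<and> \<F> \<subseteq> W ` S \<and> S \<subseteq> \<Union>\<F>"
    by (rule compactinD[OF cS _ cov]) (rule op)
  then obtain \<F> where \<F>: "finite \<F>" "\<F> \<subseteq> W ` S" "S \<subseteq> \<Union>\<F>"
    by (elim exE conjE)
  from finite_subset_image[OF \<F>(1,2)] obtain C where C: "C \<subseteq> S" "finite C" "\<F> = W ` C"
    by blast
  \<comment> \<open>Each \<open>A x\<close> contains only indices of balls meeting \<open>S\<close>,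
    and a ball meeting \<open>S\<close> does so inside one of the finitely many \<open>W x\<close>;
    so the union is exact although the single sets need not be.\<close>
  have "{i. S \<inter> rball i \<noteq> {}} = \<Union>(A ` C)"
  proof (intro equalityI subsetI)
    fix i assume "i \<in> {i. S \<inter> rball i \<noteq> {}}"
    then obtain y where y: "y \<in> S" "y \<in> rball i" by blast
    then obtain x where x: "x \<in> C" "y \<in> W x" using \<F>(3) C(3) by blast
    then have "i \<in> A x" using W C(1) y by blast
    then show "i \<in> \<Union>(A ` C)" using x(1) by blast
  next
    fix i assume "i \<in> \<Union>(A ` C)"
    then obtain x where "x \<in> C" "i \<in> A x" by blast
    then show "i \<in> {i. S \<inter> rball i \<noteq> {}}" using W C(1) by blast
  qed
  moreover have "ce_set (\<Union>(A ` C))"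
    using C(1,2) W by (intro ce_set_Union) auto
  ultimately show ?thesis
    unfolding computable_compact_def using assms(5) by simp
qed

end
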